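(* Let $\alpha:\hat{\mathfrak n}\to\hat{\mathfrak g}$ be a topologically split crossed module of topological Lie algebras over $\mathbb K$, let $\mathfrak n=\mathrm{im}(\alpha)$, $\mathfrak g=\hat{\mathfrak g}/\mathfrak n$, and let $\mathfrak z:=\ker\alpha$ be the corresponding $\hat{\mathfrak g}$-module, with characteristic class $\chi_\alpha\in H^3(\mathfrak g,\mathfrak z)$. The following are equivalent: (1) $\chi_\alpha=0$ in $H^3(\mathfrak g,\mathfrak z)$. (2) If $\hat{\mathfrak n}=\mathfrak z\oplus_f\mathfrak n$ for some $f\in Z^2(\mathfrak n,\mathfrak z)$ and the $\hat{\mathfrak g}$-action on $\hat{\mathfrak n}$ is $x.(z,n)=(x.z+\theta(x,n),[x,n])$, then $\theta:\hat{\mathfrak g}\times\mathfrak n\to\mathfrak z$ extends to a cocycle in $Z^2(\hat{\mathfrak g},\mathfrak z)$. (3) There exists a topologically split abelian extension $\mathfrak z\hookrightarrow\tilde{\mathfrak g}\xrightarrow{\,q\,}\hat{\mathfrak g}$ and a $\hat{\mathfrak g}$-equivariant equivalence $\hat{\mathfrak n}\to q^{-1}(\mathfrak n)$ of $\mathfrak z$-extensions of $\mathfrak n$.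
   Context: $\mathbb K$ is a topological field of characteristic $0$ (discrete topology allowed); topological vector spaces are Hausdorff; topological Lie algebras and modules have continuous bracket resp. continuous action map. $C^p(\mathfrak g,V)$ denotes continuous alternating $p$-linear maps, $Z^p,B^p,H^p$ continuous Lie algebra cocycles, coboundaries, cohomology, with the standard differential $d_{\mathfrak g}$. A subspace $W\subseteq V$ is topologically split if it is closed and $V\to V/W$ has a continuous linear section $\sigma$ with $W\times V/W\to V$, $(w,x)\mapsto w+\sigma(x)$, a topological isomorphism. A crossed module is a morphism $\alpha:\mathfrak h\to\hat{\mathfrak g}$ of topological Lie algebras with a continuous $\hat{\mathfrak g}$-module structure on $\mathfrak h$ such that $\alpha(x.h)=[x,\alpha(h)]$ and $\alpha(h).h'=[h,h']$ for $x\in\hat{\mathfrak g}$, $h,h'\in\mathfrak h$. It is topologically split if $\ker\alpha$ is topologically split in $\mathfrak h$ and $\mathrm{im}\,\alpha$ is topologically split in $\hat{\mathfrak g}$. Writing $\mathfrak h=\hat{\mathfrak n}$, $\mathfrak n:=\mathrm{im}(\alpha)$ is a topologically split ideal of $\hat{\mathfrak g}$, and $\alpha:\hat{\mathfrak n}\to\mathfrak n$ is viewed as a topologically split central extension of $\mathfrak n$ by $\mathfrak z:=\ker\alpha$; $\mathfrak z$ is a $\hat{\mathfrak g}$-submodule on which $\mathfrak n$ acts trivially, hence also a $\mathfrak g$-module, $\mathfrak g:=\hat{\mathfrak g}/\mathfrak n$, with quotient map $q_{\mathfrak g}:\hat{\mathfrak g}\to\mathfrak g$. For a Lie algebra $\mathfrak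 l$, an $\mathfrak l$-module $\mathfrak a$ and $f\in Z^2(\mathfrak l,\mathfrak a)$, $\mathfrak a\oplus_f\mathfrak l$ is $\mathfrak a\times\mathfrak l$ with bracket $[(a,x),(a',x')]=(x.a'-x'.a+f(x,x'),[x,x'])$. Choosing $f\in Z^2(\mathfrak n,\mathfrak z)$ with $\hat{\mathfrak n}\cong\mathfrak z\oplus_f\mathfrak n$, the $\hat{\mathfrak g}$-action has the form $x.(z,n)=(x.z+\theta(x,n),[x,n])$ with a continuous bilinear $\theta:\hat{\mathfrak g}\times\mathfrak n\to\mathfrak z$ satisfying $\theta|_{\mathfrak n\times\mathfrak n}=f$. Characteristic class: choose $\tilde f\in C^2(\hat{\mathfrak g},\mathfrak z)$ extending $\theta$ (i.e. $\tilde f|_{\hat{\mathfrak g}\times\mathfrak n}=\theta$); then $d_{\hat{\mathfrak g}}\tilde f=q_{\mathfrak g}^*\beta$ for a unique $\beta\in Z^3(\mathfrak g,\mathfrak z)$, and $\chi_\alpha:=[\beta]\in H^3(\mathfrak g,\mathfrak z)$, which is independent of the choices. An abelian extension $\mathfrak z\hookrightarrow\tilde{\mathfrak g}\xrightarrow{q}\hat{\mathfrak g}$ is a topological Lie algebra $\tilde{\mathfrak g}$ containing $\mathfrak z$ as an abelian topologically split ideal, with $\tilde{\mathfrak g}/\mathfrak z\cong\hat{\mathfrak g}$ via $q$ and inducing the given $\hat{\mathfrak g}$-module structure on $\mathfrak z$. In (3), $\hat{\mathfrak g}$ acts on $q^{-1}(\mathfrak n)$ through the adjoint action of $\tilde{\mathfrak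 g}$, and an equivalence of $\mathfrak z$-extensions of $\mathfrak n$ is an isomorphism of topological Lie algebras inducing the identity on $\mathfrak z$ and on $\mathfrak n$. *)

theory Defs
  imports "HOL-Analysis.Analysis" "HOL-Library.Set_Algebras"
begin

(* A space is a record whose carrier is the topspace of its topology; addition is that of the
   ambient type, so that subspaces and quotients by cosets (sets of type 'v set, added by
   Set_Algebras) are again such records. *)

record ('k, 'v) tvs =
  vtop :: "'v topology"
  vscale :: "'k \<Rightarrow> 'v \<Rightarrow> 'v"

record ('k, 'v) tla = "('k, 'v) tvs" +
  lbr :: "'v \<Rightarrow> 'v \<Rightarrow> 'v"

abbreviation carr :: "('k, 'v, 'm) tvs_scheme \<Rightarrow> 'v set" where
  "carr V \<equiv> topspace (vtop V)"

definition topological_field :: "'k::field topology \<Rightarrow> bool" where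
  "topological_field K \<longleftrightarrow>
     topspace K = UNIV \<and>
     continuous_map (prod_topology K K) K (\<lambda>(a, b). a + b) \<and>
     continuous_map (prod_topology K K) K (\<lambda>(a, b). a * b) \<and>
     continuous_map K K uminus \<and>
     continuous_map (subtopology K (- {0})) K inverse"


section \<open>Topological vector spaces\<close>

definition topological_vector_space ::
    "'k::field topology \<Rightarrow> ('k, 'v::ab_group_add, 'm) tvs_scheme \<Rightarrow> bool" where
  "topological_vector_space K V \<longleftrightarrow>
     vector_space (vscale V) \<and> module.subspace (vscale V) (carr V) \<and>
     Hausdorff_space (vtop V) \<and>
     continuous_map (prod_topology (vtop V) (vtop V)) (vtop V) (\<lambda>(x, y). x + y) \<and>
     continuous_map (prod_topology K (vtop V)) (vtop V) (\<lambda>(c, x). vscale V c x)"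

definition linear_map ::
    "('k, 'v::plus, 'm) tvs_scheme \<Rightarrow> ('k, 'w::plus, 'n) tvs_scheme \<Rightarrow> ('v \<Rightarrow> 'w) \<Rightarrow> bool" where
  "linear_map V W f \<longleftrightarrow>
     f ` carr V \<subseteq> carr W \<and>
     (\<forall>x\<in>carr V. \<forall>y\<in>carr V. f (x + y) = f x + f y) \<and>
     (\<forall>c. \<forall>x\<in>carr V. f (vscale V c x) = vscale W c (f x))"

definition bilinear_map ::
    "('k, 'u::plus, 'm) tvs_scheme \<Rightarrow> ('k, 'v::plus, 'n) tvs_scheme \<Rightarrow>
     ('k, 'w::plus, 'o) tvs_scheme \<Rightarrow> ('u \<Rightarrow> 'v \<Rightarrow> 'w) \<Rightarrow> bool" where
  "bilinear_map U V W b \<longleftrightarrow>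
     (\<forall>u\<in>carr U. linear_map V W (b u)) \<and> (\<forall>v\<in>carr V. linear_map U W (\<lambda>u. b u v))"

definition continuous_bilinear ::
    "('k, 'u::plus, 'm) tvs_scheme \<Rightarrow> ('k, 'v::plus, 'n) tvs_scheme \<Rightarrow>
     ('k, 'w::plus, 'o) tvs_scheme \<Rightarrow> ('u \<Rightarrow> 'v \<Rightarrow> 'w) \<Rightarrow> bool" where
  "continuous_bilinear U V W b \<longleftrightarrow>
     bilinear_map U V W b \<and>
     continuous_map (prod_topology (vtop U) (vtop V)) (vtop W) (\<lambda>(u, v). b u v)"

definition sub :: "('k, 'v, 'm) tvs_scheme \<Rightarrow> 'v set \<Rightarrow> ('k, 'v, 'm) tvs_scheme" where
  "sub V W = V\<lparr>vtop := subtopology (vtop V) W\<rparr>"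

definition quot_topology :: "'v topology \<Rightarrow> ('v \<Rightarrow> 'w) \<Rightarrow> 'w topology" where
  "quot_topology T q =
     topology (\<lambda>U. U \<subseteq> q ` topspace T \<and> openin T {x \<in> topspace T. q x \<in> U})"

text \<open>The quotient \<open>V/W\<close> by a subspace: its elements are the cosets \<open>x +o W\<close>, and the sum of
  two cosets is their sum as sets.\<close>

definition quot_tvs ::
    "('k, 'v::plus, 'm) tvs_scheme \<Rightarrow> 'v set \<Rightarrow> ('k, 'v set) tvs" where
  "quot_tvs V W =
     \<lparr>vtop = quot_topology (vtop V) (\<lambda>x. x +o W),
      vscale = (\<lambda>c X. \<Union>x\<in>X. vscale V c x +o W)\<rparr>"

definition topologically_split ::
    "('k::field, 'v::ab_group_add, 'm) tvs_scheme \<Rightarrow> 'v set \<Rightarrow> bool" where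
  "topologically_split V W \<longleftrightarrow>
     W \<subseteq> carr V \<and> module.subspace (vscale V) W \<and> closedin (vtop V) W \<and>
     (\<exists>\<sigma>. linear_map (quot_tvs V W) V \<sigma> \<and>
          continuous_map (vtop (quot_tvs V W)) (vtop V) \<sigma> \<and>
          (\<forall>X\<in>carr (quot_tvs V W). \<sigma> X +o W = X) \<and>
          homeomorphic_map
            (prod_topology (subtopology (vtop V) W) (vtop (quot_tvs V W))) (vtop V)
            (\<lambda>(w, X). w + \<sigma> X))"


section \<open>Topological Lie algebras and modules\<close>

definition topological_lie_algebra ::
    "'k::field topology \<Rightarrow> ('k, 'v::ab_group_add, 'm) tla_scheme \<Rightarrow> bool" where
  "topological_lie_algebra K L \<longleftrightarrow>
     topological_vector_space K L \<and>
     continuous_bilinear L L L (lbr L) \<and>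
     (\<forall>x\<in>carr L. lbr L x x = 0) \<and>
     (\<forall>x\<in>carr L. \<forall>y\<in>carr L. \<forall>z\<in>carr L.
        lbr L x (lbr L y z) + lbr L y (lbr L z x) + lbr L z (lbr L x y) = 0)"

definition topological_module ::
    "'k::field topology \<Rightarrow> ('k, 'l::ab_group_add, 'm) tla_scheme \<Rightarrow>
     ('k, 'v::ab_group_add, 'n) tvs_scheme \<Rightarrow> ('l \<Rightarrow> 'v \<Rightarrow> 'v) \<Rightarrow> bool" where
  "topological_module K L V \<rho> \<longleftrightarrow>
     topological_vector_space K V \<and>
     continuous_bilinear L V V \<rho> \<and>
     (\<forall>x\<in>carr L. \<forall>y\<in>carr L. \<forall>v\<in>carr V.
        \<rho> (lbr L x y) v = \<rho> x (\<rho> y v) - \<rho> y (\<rho> x v))"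

definition lie_morphism ::
    "('k, 'v::plus, 'm) tla_scheme \<Rightarrow> ('k, 'w::plus, 'n) tla_scheme \<Rightarrow> ('v \<Rightarrow> 'w) \<Rightarrow> bool" where
  "lie_morphism L M f \<longleftrightarrow>
     linear_map L M f \<and> continuous_map (vtop L) (vtop M) f \<and>
     (\<forall>x\<in>carr L. \<forall>y\<in>carr L. f (lbr L x y) = lbr M (f x) (f y))"

definition lie_iso ::
    "('k, 'v::plus, 'm) tla_scheme \<Rightarrow> ('k, 'w::plus, 'n) tla_scheme \<Rightarrow> ('v \<Rightarrow> 'w) \<Rightarrow> bool" where
  "lie_iso L M f \<longleftrightarrow> lie_morphism L M f \<and> homeomorphic_map (vtop L) (vtop M) f"

definition quot_lie ::
    "('k, 'v::plus, 'm) tla_scheme \<Rightarrow> 'v set \<Rightarrow> ('k, 'v set) tla" where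
  "quot_lie L N = tvs.extend (quot_tvs L N)
     \<lparr>lbr = (\<lambda>X Y. \<Union>x\<in>X. \<Union>y\<in>Y. lbr L x y +o N)\<rparr>"

text \<open>The action of \<open>L/N\<close> on a module on which \<open>N\<close> acts trivially; the result does not depend on
  the chosen representative.\<close>

definition quot_act :: "('v \<Rightarrow> 'w \<Rightarrow> 'w) \<Rightarrow> 'v set \<Rightarrow> 'w \<Rightarrow> 'w" where
  "quot_act \<rho> X w = \<rho> (SOME x. x \<in> X) w"


section \<open>Continuous Lie algebra cohomology\<close>

text \<open>A \<open>p\<close>-cochain takes a list of \<open>p\<close> elements of the carrier; its values on other lists are
  irrelevant, and cochains are compared only on such lists.\<close>

definition tuples :: "('k, 'l, 'm) tvs_scheme \<Rightarrow> nat \<Rightarrow> 'l list set" where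
  "tuples L p = {xs. length xs = p \<and> set xs \<subseteq> carr L}"

definition cochains ::
    "('k, 'l::plus, 'm) tvs_scheme \<Rightarrow> ('k, 'v::ab_group_add, 'n) tvs_scheme \<Rightarrow> nat \<Rightarrow>
     ('l list \<Rightarrow> 'v) set" where
  "cochains L V p =
     {\<omega>. (\<forall>xs\<in>tuples L p. \<forall>i<p. linear_map L V (\<lambda>x. \<omega> (xs[i := x]))) \<and>
         (\<forall>xs\<in>tuples L p. \<forall>i<p. \<forall>j<p. i \<noteq> j \<longrightarrow> xs ! i = xs ! j \<longrightarrow> \<omega> xs = 0) \<and>
         continuous_map (product_topology (\<lambda>_. vtop L) {..<p}) (vtop V)
           (\<lambda>x. \<omega> (map x [0..<p]))}"

definition del :: "nat \<Rightarrow> 'a list \<Rightarrow> 'a list" where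
  "del i xs = take i xs @ drop (Suc i) xs"

definition differential ::
    "('k, 'l, 'm) tla_scheme \<Rightarrow> ('k::field, 'v::ab_group_add, 'n) tvs_scheme \<Rightarrow>
     ('l \<Rightarrow> 'v \<Rightarrow> 'v) \<Rightarrow> ('l list \<Rightarrow> 'v) \<Rightarrow> 'l list \<Rightarrow> 'v" where
  "differential L V \<rho> \<omega> xs =
     (\<Sum>j<length xs. vscale V ((-1) ^ j) (\<rho> (xs ! j) (\<omega> (del j xs)))) +
     (\<Sum>j<length xs. \<Sum>i<j.
        vscale V ((-1) ^ (i + j)) (\<omega> (lbr L (xs ! i) (xs ! j) # del i (del j xs))))"

definition cocycles ::
    "('k::field, 'l::plus, 'm) tla_scheme \<Rightarrow> ('k, 'v::ab_group_add, 'n) tvs_scheme \<Rightarrow>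
     ('l \<Rightarrow> 'v \<Rightarrow> 'v) \<Rightarrow> nat \<Rightarrow> ('l list \<Rightarrow> 'v) set" where
  "cocycles L V \<rho> p =
     {\<omega> \<in> cochains L V p. \<forall>xs\<in>tuples L (Suc p). differential L V \<rho> \<omega> xs = 0}"

definition coboundaries ::
    "('k::field, 'l::plus, 'm) tla_scheme \<Rightarrow> ('k, 'v::ab_group_add, 'n) tvs_scheme \<Rightarrow>
     ('l \<Rightarrow> 'v \<Rightarrow> 'v) \<Rightarrow> nat \<Rightarrow> ('l list \<Rightarrow> 'v) set" where
  "coboundaries L V \<rho> p =
     {\<omega> \<in> cochains L V p.
        case p of
          0 \<Rightarrow> \<forall>xs\<in>tuples L p. \<omega> xs = 0
        | Suc r \<Rightarrow> \<exists>\<gamma>\<in>cochains L V r. \<forall>xs\<in>tuples L p. \<omega> xs = differential L V \<rho> \<gamma> xs}"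

definition cohomology_rel ::
    "('k::field, 'l::plus, 'm) tla_scheme \<Rightarrow> ('k, 'v::ab_group_add, 'n) tvs_scheme \<Rightarrow>
     ('l \<Rightarrow> 'v \<Rightarrow> 'v) \<Rightarrow> nat \<Rightarrow> (('l list \<Rightarrow> 'v) \<times> ('l list \<Rightarrow> 'v)) set" where
  "cohomology_rel L V \<rho> p =
     {(\<omega>, \<omega>'). \<omega> \<in> cocycles L V \<rho> p \<and> \<omega>' \<in> cocycles L V \<rho> p \<and>
              (\<lambda>xs. \<omega> xs - \<omega>' xs) \<in> coboundaries L V \<rho> p}"

text \<open>An element of \<open>H\<^sup>p = cocycles L V \<rho> p // cohomology_rel L V \<rho> p\<close>.\<close>

definition cohomology_class ::
    "('k::field, 'l::plus, 'm) tla_scheme \<Rightarrow> ('k, 'v::ab_group_add, 'n) tvs_scheme \<Rightarrow>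
     ('l \<Rightarrow> 'v \<Rightarrow> 'v) \<Rightarrow> nat \<Rightarrow> ('l list \<Rightarrow> 'v) \<Rightarrow> ('l list \<Rightarrow> 'v) set" where
  "cohomology_class L V \<rho> p \<omega> = cohomology_rel L V \<rho> p `` {\<omega>}"


section \<open>Abelian extensions\<close>

definition twisted_sum ::
    "('k, 'a::ab_group_add, 'm) tvs_scheme \<Rightarrow> ('k, 'l::plus, 'n) tla_scheme \<Rightarrow>
     ('l \<Rightarrow> 'a \<Rightarrow> 'a) \<Rightarrow> ('l list \<Rightarrow> 'a) \<Rightarrow> ('k, 'a \<times> 'l) tla" where
  "twisted_sum A L \<rho> f =
     \<lparr>vtop = prod_topology (vtop A) (vtop L),
      vscale = (\<lambda>c (a, x). (vscale A c a, vscale L c x)),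
      lbr = (\<lambda>(a, x) (a', x'). (\<rho> x a' - \<rho> x' a + f [x, x'], lbr L x x'))\<rparr>"

text \<open>\<open>A \<rightarrow> E \<rightarrow> G\<close> via \<open>\<iota>\<close> and \<open>q\<close>. The clause \<open>quotient_map\<close> says that \<open>q\<close> induces an
  isomorphism \<open>E/A \<cong> G\<close> of topological Lie algebras.\<close>

definition split_abelian_extension ::
    "'k::field topology \<Rightarrow> ('k, 'a::ab_group_add, 'm) tvs_scheme \<Rightarrow> ('l \<Rightarrow> 'a \<Rightarrow> 'a) \<Rightarrow>
     ('k, 'e::ab_group_add, 'n) tla_scheme \<Rightarrow> ('k, 'l::ab_group_add, 'o) tla_scheme \<Rightarrow>
     ('a \<Rightarrow> 'e) \<Rightarrow> ('e \<Rightarrow> 'l) \<Rightarrow> bool" where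
  "split_abelian_extension K A \<rho> E G \<iota> q \<longleftrightarrow>
     topological_lie_algebra K E \<and>
     linear_map A E \<iota> \<and> embedding_map (vtop A) (vtop E) \<iota> \<and>
     (\<forall>a\<in>carr A. \<forall>b\<in>carr A. lbr E (\<iota> a) (\<iota> b) = 0) \<and>
     (\<forall>e\<in>carr E. \<forall>a\<in>carr A. lbr E e (\<iota> a) \<in> \<iota> ` carr A) \<and>
     topologically_split E (\<iota> ` carr A) \<and>
     lie_morphism E G q \<and> quotient_map (vtop E) (vtop G) q \<and>
     {e \<in> carr E. q e = 0} = \<iota> ` carr A \<and>
     (\<forall>e\<in>carr E. \<forall>a\<in>carr A. lbr E e (\<iota> a) = \<iota> (\<rho> (q e) a))"


section \<open>Crossed modules\<close>

definition crossed_module ::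
    "'k::field topology \<Rightarrow> ('k, 'h::ab_group_add, 'm) tla_scheme \<Rightarrow>
     ('k, 'g::ab_group_add, 'n) tla_scheme \<Rightarrow> ('g \<Rightarrow> 'h \<Rightarrow> 'h) \<Rightarrow> ('h \<Rightarrow> 'g) \<Rightarrow> bool" where
  "crossed_module K H G act \<alpha> \<longleftrightarrow>
     topological_lie_algebra K H \<and> topological_lie_algebra K G \<and>
     lie_morphism H G \<alpha> \<and> topological_module K G H act \<and>
     (\<forall>x\<in>carr G. \<forall>h\<in>carr H. \<alpha> (act x h) = lbr G x (\<alpha> h)) \<and>
     (\<forall>h\<in>carr H. \<forall>h'\<in>carr H. act (\<alpha> h) h' = lbr H h h')"

definition ker_mod ::
    "('k, 'h::ab_group_add, 'm) tla_scheme \<Rightarrow> ('h \<Rightarrow> 'g::ab_group_add) \<Rightarrow>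
     ('k, 'h, 'm) tla_scheme" where
  "ker_mod H \<alpha> = sub H {h \<in> carr H. \<alpha> h = 0}"

definition im_lie ::
    "('k, 'h, 'm) tla_scheme \<Rightarrow> ('k, 'g, 'n) tla_scheme \<Rightarrow> ('h \<Rightarrow> 'g) \<Rightarrow>
     ('k, 'g, 'n) tla_scheme" where
  "im_lie H G \<alpha> = sub G (\<alpha> ` carr H)"

text \<open>The last clause makes \<open>\<alpha> : H \<rightarrow> im \<alpha>\<close> a topologically split central extension by \<open>ker \<alpha>\<close>.
  What it adds to the others is that the continuous bijection \<open>H/ker \<alpha> \<rightarrow> im \<alpha>\<close> is a
  homeomorphism, which the splitting of \<open>ker \<alpha>\<close> and \<open>im \<alpha>\<close> alone does not imply.\<close>

definition split_crossed_module ::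
    "'k::field topology \<Rightarrow> ('k, 'h::ab_group_add, 'm) tla_scheme \<Rightarrow>
     ('k, 'g::ab_group_add, 'n) tla_scheme \<Rightarrow> ('g \<Rightarrow> 'h \<Rightarrow> 'h) \<Rightarrow> ('h \<Rightarrow> 'g) \<Rightarrow> bool" where
  "split_crossed_module K H G act \<alpha> \<longleftrightarrow>
     crossed_module K H G act \<alpha> \<and>
     topologically_split H {h \<in> carr H. \<alpha> h = 0} \<and>
     topologically_split G (\<alpha> ` carr H) \<and>
     split_abelian_extension K (ker_mod H \<alpha>) act H (im_lie H G \<alpha>) (\<lambda>h. h) \<alpha>"

text \<open>\<open>\<Phi>\<close> identifies \<open>H\<close> with the central extension of \<open>im \<alpha>\<close> by \<open>ker \<alpha>\<close> given by \<open>f\<close>, and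
  \<open>\<theta>\<close> describes the action of \<open>G\<close> under this identification. That \<open>\<theta>\<close> restricts to \<open>f\<close> follows
  from \<open>act (\<alpha> h) h' = lbr H h h'\<close>.\<close>

definition presentation ::
    "('k::field, 'h::ab_group_add, 'm) tla_scheme \<Rightarrow> ('k, 'g::ab_group_add, 'n) tla_scheme \<Rightarrow>
     ('g \<Rightarrow> 'h \<Rightarrow> 'h) \<Rightarrow> ('h \<Rightarrow> 'g) \<Rightarrow>
     ('g list \<Rightarrow> 'h) \<Rightarrow> ('g \<Rightarrow> 'g \<Rightarrow> 'h) \<Rightarrow> ('h \<times> 'g \<Rightarrow> 'h) \<Rightarrow> bool" where
  "presentation H G act \<alpha> f \<theta> \<Phi> \<longleftrightarrow>
     (let Z = ker_mod H \<alpha>; N = im_lie H G \<alpha> in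
        f \<in> cocycles N Z act 2 \<and>
        lie_iso (twisted_sum Z N act f) H \<Phi> \<and>
        (\<forall>z\<in>carr Z. \<Phi> (z, 0) = z) \<and>
        (\<forall>z\<in>carr Z. \<forall>n\<in>carr N. \<alpha> (\<Phi> (z, n)) = n) \<and>
        continuous_bilinear G N Z \<theta> \<and>
        (\<forall>x\<in>carr G. \<forall>z\<in>carr Z. \<forall>n\<in>carr N.
           act x (\<Phi> (z, n)) = \<Phi> (act x z + \<theta> x n, lbr G x n)))"

definition extends_theta ::
    "('k::field, 'h::ab_group_add, 'm) tla_scheme \<Rightarrow> ('k, 'g::ab_group_add, 'n) tla_scheme \<Rightarrow>
     ('h \<Rightarrow> 'g) \<Rightarrow> ('g \<Rightarrow> 'g \<Rightarrow> 'h) \<Rightarrow> ('g list \<Rightarrow> 'h) \<Rightarrow> bool" where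
  "extends_theta H G \<alpha> \<theta> F \<longleftrightarrow>
     (\<forall>x\<in>carr G. \<forall>n\<in>carr (im_lie H G \<alpha>). F [x, n] = \<theta> x n)"

definition char_cocycle ::
    "('k::field, 'h::ab_group_add, 'm) tla_scheme \<Rightarrow> ('k, 'g::ab_group_add, 'n) tla_scheme \<Rightarrow>
     ('g \<Rightarrow> 'h \<Rightarrow> 'h) \<Rightarrow> ('h \<Rightarrow> 'g) \<Rightarrow> ('g set list \<Rightarrow> 'h) \<Rightarrow> bool" where
  "char_cocycle H G act \<alpha> \<beta> \<longleftrightarrow>
     (let Z = ker_mod H \<alpha>; n = \<alpha> ` carr H in
        \<exists>f \<theta> \<Phi> F.
          presentation H G act \<alpha> f \<theta> \<Phi> \<and>
          F \<in> cochains G Z 2 \<and> extends_theta H G \<alpha> \<theta> F \<and>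
          \<beta> \<in> cocycles (quot_lie G n) Z (quot_act act) 3 \<and>
          (\<forall>xs\<in>tuples G 3. differential G Z act F xs = \<beta> (map (\<lambda>x. x +o n) xs)))"

definition H3_class ::
    "('k::field, 'h::ab_group_add, 'm) tla_scheme \<Rightarrow> ('k, 'g::ab_group_add, 'n) tla_scheme \<Rightarrow>
     ('g \<Rightarrow> 'h \<Rightarrow> 'h) \<Rightarrow> ('h \<Rightarrow> 'g) \<Rightarrow> ('g set list \<Rightarrow> 'h) \<Rightarrow> ('g set list \<Rightarrow> 'h) set" where
  "H3_class H G act \<alpha> \<beta> =
     cohomology_class (quot_lie G (\<alpha> ` carr H)) (ker_mod H \<alpha>) (quot_act act) 3 \<beta>"

definition char_class ::
    "('k::field, 'h::ab_group_add, 'm) tla_scheme \<Rightarrow> ('k, 'g::ab_group_add, 'n) tla_scheme \<Rightarrow>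
     ('g \<Rightarrow> 'h \<Rightarrow> 'h) \<Rightarrow> ('h \<Rightarrow> 'g) \<Rightarrow> ('g set list \<Rightarrow> 'h) set" where
  "char_class H G act \<alpha> =
     (THE c. \<exists>\<beta>. char_cocycle H G act \<alpha> \<beta> \<and> c = H3_class H G act \<alpha> \<beta>)"

text \<open>\<open>x = q e\<close> acts on \<open>q\<^sup>-\<^sup>1(im \<alpha>)\<close> by the bracket with \<open>e\<close>; this is the equivariance condition
  in the last line. In the theorem the existence of \<open>E\<close> is asserted on the ambient type
  \<open>'h \<times> 'g\<close>, since a topologically split extension is isomorphic to one with carrier
  \<open>ker \<alpha> \<times> carr G\<close>; that any such \<open>E\<close> forces the characteristic class to vanish is asserted over
  an arbitrary type \<open>'e\<close>.\<close>

definition equivariant_equivalence ::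
    "('k::field, 'h::ab_group_add, 'm) tla_scheme \<Rightarrow> ('g \<Rightarrow> 'h \<Rightarrow> 'h) \<Rightarrow>
     ('h \<Rightarrow> 'g::ab_group_add) \<Rightarrow> ('k, 'e::ab_group_add, 'o) tla_scheme \<Rightarrow>
     ('h \<Rightarrow> 'e) \<Rightarrow> ('e \<Rightarrow> 'g) \<Rightarrow> ('h \<Rightarrow> 'e) \<Rightarrow> bool" where
  "equivariant_equivalence H act \<alpha> E \<iota> q \<phi> \<longleftrightarrow>
     lie_iso H (sub E {e \<in> carr E. q e \<in> \<alpha> ` carr H}) \<phi> \<and>
     (\<forall>z\<in>carr (ker_mod H \<alpha>). \<phi> z = \<iota> z) \<and>
     (\<forall>h\<in>carr H. q (\<phi> h) = \<alpha> h) \<and>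
     (\<forall>e\<in>carr E. \<forall>h\<in>carr H. \<phi> (act (q e) h) = lbr E e (\<phi> h))"

end

theory Submission
  imports Defs
begin

text \<open>A presentation of the crossed module amounts to a continuous linear section \<open>s\<close> of \<open>\<alpha>\<close> over
  \<open>im \<alpha>\<close>, with \<open>\<theta>(x, m) = x.s(m) - s[x, m]\<close>. If \<open>p\<close> is a continuous projection of \<open>G\<close> onto
  \<open>im \<alpha>\<close>, then \<open>F(x, y) = \<theta>(x, p y) - \<theta>(y, p x) - \<theta>(p x, p y)\<close> is a \<open>2\<close>-cochain extending
  \<open>\<theta>\<close>, and the fact that \<open>G\<close> acts by a representation says exactly that \<open>d F\<close> vanishes as soon as
  one argument lies in \<open>im \<alpha>\<close>; hence \<open>d F\<close> descends to \<open>G / im \<alpha>\<close>. A second presentation changes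
  \<open>s\<close> by a linear map \<open>im \<alpha> \<rightarrow> ker \<alpha>\<close>, which composed with \<open>p\<close> gives a \<open>1\<close>-cochain \<open>l\<close> on \<open>G\<close>, and
  the difference of the two extensions minus \<open>d l\<close> descends to \<open>G / im \<alpha>\<close>. So the class of the
  descended cocycle is well defined, and it vanishes iff \<open>F\<close> can be corrected by a cochain pulled
  back from \<open>G / im \<alpha>\<close> to a cocycle. Cocycles extending \<open>\<theta>\<close> correspond to extensions of \<open>G\<close>: in
  one direction take the twisted sum, in the other a linear section whose restriction to
  \<open>im \<alpha>\<close> is the image of \<open>s\<close>.\<close>


section \<open>Topological vector spaces\<close>

abbreviation continuous_linear ::
    "('k, 'v::plus, 'm) tvs_scheme \<Rightarrow> ('k, 'w::plus, 'n) tvs_scheme \<Rightarrow> ('v \<Rightarrow> 'w) \<Rightarrow> bool" where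
  "continuous_linear V W f \<equiv> linear_map V W f \<and> continuous_map (vtop V) (vtop W) f"

lemma tvs_module:
  assumes "topological_vector_space K V"
  shows "Modules.module (vscale V)"
  using assms by (simp add: topological_vector_space_def vector_space_def Modules.module_def)

text \<open>The closure rules have membership premises because the carrier is only a subspace of the
  ambient type. The scalar identities have none: \<open>vscale V\<close> makes the whole type a
  vector space.\<close>

lemma tvs_simps:
  assumes "topological_vector_space K V"
  shows "0 \<in> carr V"
    and "x \<in> carr V \<Longrightarrow> y \<in> carr V \<Longrightarrow> x + y \<in> carr V"
    and "x \<in> carr V \<Longrightarrow> y \<in> carr V \<Longrightarrow> x - y \<in> carr V"
    and "x \<in> carr V \<Longrightarrow> - x \<in> carr V"
    and "x \<in> carr V \<Longrightarrow> vscale V c x \<in> carr V"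
    and "vscale V 1 x = x"
    and "vscale V (- 1) x = - x"
    and "vscale V c (x + y) = vscale V c x + vscale V c y"
    and "vscale V c (x - y) = vscale V c x - vscale V c y"
    and "vscale V c (- x) = - vscale V c x"
    and "vscale V c 0 = 0"
proof -
  interpret module "vscale V" by (rule tvs_module[OF assms])
  have s: "subspace (carr V)"
    using assms by (simp add: topological_vector_space_def)
  show "0 \<in> carr V" "x \<in> carr V \<Longrightarrow> y \<in> carr V \<Longrightarrow> x + y \<in> carr V"
    "x \<in> carr V \<Longrightarrow> y \<in> carr V \<Longrightarrow> x - y \<in> carr V" "x \<in> carr V \<Longrightarrow> - x \<in> carr V"
    "x \<in> carr V \<Longrightarrow> vscale V c x \<in> carr V"
    using s by (simp_all add: subspace_0 subspace_add subspace_diff subspace_neg subspace_scale)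
  show "vscale V 1 x = x" "vscale V (- 1) x = - x"
    "vscale V c (x + y) = vscale V c x + vscale V c y"
    "vscale V c (x - y) = vscale V c x - vscale V c y"
    "vscale V c (- x) = - vscale V c x" "vscale V c 0 = 0"
    by (simp_all add: scale_right_distrib scale_right_diff_distrib)
qed

lemma linear_map_in: "linear_map V W f \<Longrightarrow> x \<in> carr V \<Longrightarrow> f x \<in> carr W"
  by (auto simp: linear_map_def)

lemma linear_map_simps:
  fixes V :: "('k::field, 'v::ab_group_add, 'm) tvs_scheme"
    and W :: "('k, 'w::ab_group_add, 'n) tvs_scheme"
  assumes V: "topological_vector_space K V" and f: "linear_map V W f"
  shows "x \<in> carr V \<Longrightarrow> f x \<in> carr W"
    and "x \<in> carr V \<Longrightarrow> y \<in> carr V \<Longrightarrow> f (x + y) = f x + f y"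
    and "x \<in> carr V \<Longrightarrow> y \<in> carr V \<Longrightarrow> f (x - y) = f x - f y"
    and "x \<in> carr V \<Longrightarrow> f (- x) = - f x"
    and "f 0 = 0"
    and "x \<in> carr V \<Longrightarrow> f (vscale V c x) = vscale W c (f x)"
proof -
  note [simp] = tvs_simps[OF V]
  have add: "f (x + y) = f x + f y" if "x \<in> carr V" "y \<in> carr V" for x y
    using f that by (simp add: linear_map_def)
  have z: "f 0 = 0"
    using add[of 0 0] by simp
  have neg: "f (- x) = - f x" if "x \<in> carr V" for x
    using add[of x "- x"] that z by (simp add: eq_neg_iff_add_eq_0 add.commute)
  show "x \<in> carr V \<Longrightarrow> f x \<in> carr W" "x \<in> carr V \<Longrightarrow> f (vscale V c x) = vscale W c (f x)"
    using f by (auto simp: linear_map_def)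
  show "x \<in> carr V \<Longrightarrow> y \<in> carr V \<Longrightarrow> f (x + y) = f x + f y" "f 0 = 0"
    "x \<in> carr V \<Longrightarrow> f (- x) = - f x" by (fact add z neg)+
  show "x \<in> carr V \<Longrightarrow> y \<in> carr V \<Longrightarrow> f (x - y) = f x - f y"
    using add[of x "- y"] by (simp add: neg)
qed

lemma linear_mapI:
  assumes "\<And>x. x \<in> carr V \<Longrightarrow> f x \<in> carr W"
    and "\<And>x y. x \<in> carr V \<Longrightarrow> y \<in> carr V \<Longrightarrow> f (x + y) = f x + f y"
    and "\<And>c x. x \<in> carr V \<Longrightarrow> f (vscale V c x) = vscale W c (f x)"
  shows "linear_map V W f"
  using assms by (auto simp: linear_map_def)

lemma linear_map_comp:
  "linear_map U V f \<Longrightarrow> linear_map V W g \<Longrightarrow> linear_map U W (\<lambda>x. g (f x))"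
  by (auto simp: linear_map_def image_subset_iff)

lemma linear_map_diff:
  assumes W: "topological_vector_space K W" and f: "linear_map V W f" and g: "linear_map V W g"
  shows "linear_map V W (\<lambda>x. f x - g x)"
  using f g by (auto simp: linear_map_def image_subset_iff tvs_simps[OF W])

lemma linear_map_add:
  assumes W: "topological_vector_space K W" and f: "linear_map V W f" and g: "linear_map V W g"
  shows "linear_map V W (\<lambda>x. f x + g x)"
  using f g by (auto simp: linear_map_def image_subset_iff tvs_simps[OF W])

lemma linear_map_zero:
  assumes W: "topological_vector_space K W"
  shows "linear_map V W (\<lambda>x. 0)"
  by (auto simp: linear_map_def image_subset_iff tvs_simps[OF W])

lemma bilinear_mapD:
  assumes "bilinear_map U V W b"
  shows "u \<in> carr U \<Longrightarrow> linear_map V W (b u)" "v \<in> carr V \<Longrightarrow> linear_map U W (\<lambda>u. b u v)"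
  using assms by (auto simp: bilinear_map_def)

lemma bilinear_simps:
  fixes U :: "('k::field, 'u::ab_group_add, 'm) tvs_scheme"
    and V :: "('k, 'v::ab_group_add, 'n) tvs_scheme"
    and W :: "('k, 'w::ab_group_add, 'o) tvs_scheme"
  assumes U: "topological_vector_space K U" and V: "topological_vector_space K V"
    and b: "bilinear_map U V W b"
  shows "u \<in> carr U \<Longrightarrow> v \<in> carr V \<Longrightarrow> b u v \<in> carr W"
    and "u \<in> carr U \<Longrightarrow> v \<in> carr V \<Longrightarrow> v' \<in> carr V \<Longrightarrow> b u (v + v') = b u v + b u v'"
    and "u \<in> carr U \<Longrightarrow> v \<in> carr V \<Longrightarrow> v' \<in> carr V \<Longrightarrow> b u (v - v') = b u v - b u v'"
    and "u \<in> carr U \<Longrightarrow> v \<in> carr V \<Longrightarrow> b u (- v) = - b u v"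
    and "u \<in> carr U \<Longrightarrow> b u 0 = 0"
    and "u \<in> carr U \<Longrightarrow> u' \<in> carr U \<Longrightarrow> v \<in> carr V \<Longrightarrow> b (u + u') v = b u v + b u' v"
    and "u \<in> carr U \<Longrightarrow> u' \<in> carr U \<Longrightarrow> v \<in> carr V \<Longrightarrow> b (u - u') v = b u v - b u' v"
    and "u \<in> carr U \<Longrightarrow> v \<in> carr V \<Longrightarrow> b (- u) v = - b u v"
    and "v \<in> carr V \<Longrightarrow> b 0 v = 0"
    and "u \<in> carr U \<Longrightarrow> v \<in> carr V \<Longrightarrow> b u (vscale V c v) = vscale W c (b u v)"
    and "u \<in> carr U \<Longrightarrow> v \<in> carr V \<Longrightarrow> b (vscale U c u) v = vscale W c (b u v)"
  by (simp_all only: linear_map_simps[OF V bilinear_mapD(1)[OF b]]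
      linear_map_simps[OF U bilinear_mapD(2)[OF b]])

text \<open>Polarization: expanding \<open>b (x + y) (x + y) = 0\<close> leaves only the two mixed
  terms. It serves Lie brackets and two-cochains alike.\<close>

lemma alternating_antisym:
  fixes U :: "('k::field, 'u::ab_group_add, 'm) tvs_scheme"
    and W :: "('k, 'w::ab_group_add, 'o) tvs_scheme"
  assumes U: "topological_vector_space K U" and b: "bilinear_map U U W b"
    and alt: "\<And>x. x \<in> carr U \<Longrightarrow> b x x = 0" and x: "x \<in> carr U" "y \<in> carr U"
  shows "b y x = - b x y"
proof -
  have "0 = b (x + y) (x + y)"
    using x alt by (simp add: tvs_simps[OF U])
  also have "\<dots> = b x y + b y x"
    using x by (simp add: tvs_simps[OF U] bilinear_simps[OF U U b] alt[OF x(1)] alt[OF x(2)] add.commute)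
  finally show ?thesis
    by (metis eq_neg_iff_add_eq_0 add.commute)
qed

section \<open>Continuity of the vector space operations\<close>

lemma continuous_map_tvs_add:
  assumes "topological_vector_space K V" "continuous_map X (vtop V) f" "continuous_map X (vtop V) g"
  shows "continuous_map X (vtop V) (\<lambda>x. f x + g x)"
proof -
  have "continuous_map (prod_topology (vtop V) (vtop V)) (vtop V) (\<lambda>(x, y). x + y)"
    using assms(1) by (simp add: topological_vector_space_def)
  from continuous_map_compose[OF continuous_map_pairedI[OF assms(2,3)] this]
  show ?thesis by (simp add: o_def)
qed

lemma continuous_map_tvs_scale:
  assumes "topological_vector_space K V" "continuous_map X K a" "continuous_map X (vtop V) f"
  shows "continuous_map X (vtop V) (\<lambda>x. vscale V (a x) (f x))"
proof -
  have "continuous_map (prod_topology K (vtop V)) (vtop V) (\<lambda>(c, x). vscale V c x)"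
    using assms(1) by (simp add: topological_vector_space_def)
  from continuous_map_compose[OF continuous_map_pairedI[OF assms(2,3)] this]
  show ?thesis by (simp add: o_def)
qed

text \<open>Negation is scaling by the constant \<open>- 1\<close>, and
  \<open>topspace K = UNIV\<close> makes this constant a continuous map into
  \<open>K\<close>.\<close>

lemma continuous_map_tvs_minus:
  assumes K: "topspace K = UNIV" and V: "topological_vector_space K V"
    and f: "continuous_map X (vtop V) f"
  shows "continuous_map X (vtop V) (\<lambda>x. - f x)"
  using continuous_map_tvs_scale[OF V _ f, of "\<lambda>_. - 1"] K by (simp add: tvs_simps[OF V])

lemma continuous_map_tvs_diff:
  assumes K: "topspace K = UNIV" and V: "topological_vector_space K V"
    and f: "continuous_map X (vtop V) f" and g: "continuous_map X (vtop V) g"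
  shows "continuous_map X (vtop V) (\<lambda>x. f x - g x)"
  using continuous_map_tvs_add[OF V f continuous_map_tvs_minus[OF K V g]] by simp

lemma continuous_bilinear_compose:
  assumes "continuous_bilinear U V W b"
    and "continuous_map X (vtop U) f" "continuous_map X (vtop V) g"
  shows "continuous_map X (vtop W) (\<lambda>x. b (f x) (g x))"
proof -
  have "continuous_map (prod_topology (vtop U) (vtop V)) (vtop W) (\<lambda>(u, v). b u v)"
    using assms(1) by (simp add: continuous_bilinear_def)
  from continuous_map_compose[OF continuous_map_pairedI[OF assms(2,3)] this]
  show ?thesis by (simp add: o_def)
qed

section \<open>Subspaces with the induced structure\<close>

lemma sub_simps [simp]:
  "vtop (sub V W) = subtopology (vtop V) W" "vscale (sub V W) = vscale V"
  by (simp_all add: sub_def)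

lemma lbr_sub [simp]: "lbr (sub V W) = lbr V"
  by (simp add: sub_def)

lemma tvs_sub:
  assumes V: "topological_vector_space K V" and W: "module.subspace (vscale V) W" "W \<subseteq> carr V"
  shows "topological_vector_space K (sub V W)"
proof -
  interpret module "vscale V" by (rule tvs_module[OF V])
  have c: "carr (sub V W) = W" using W by auto
  have f: "continuous_map (prod_topology (subtopology (vtop V) W) (subtopology (vtop V) W)) (vtop V) fst"
    "continuous_map (prod_topology (subtopology (vtop V) W) (subtopology (vtop V) W)) (vtop V) snd"
    "continuous_map (prod_topology K (subtopology (vtop V) W)) (vtop V) snd"
    using continuous_map_fst continuous_map_snd continuous_map_into_fulltopology by blast+
  have 1: "continuous_map (prod_topology (subtopology (vtop V) W) (subtopology (vtop V) W))
       (vtop V) (\<lambda>(x, y). x + y)"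
    using continuous_map_tvs_add[OF V f(1,2)] by (simp add: case_prod_unfold)
  have 2: "continuous_map (prod_topology K (subtopology (vtop V) W)) (vtop V) (\<lambda>(c, x). vscale V c x)"
    using continuous_map_tvs_scale[OF V continuous_map_fst f(3)] by (simp add: case_prod_unfold)
  show ?thesis
    using V W 1 2 unfolding topological_vector_space_def c
    by (auto simp: Hausdorff_space_subtopology continuous_map_in_subtopology
        subspace_add subspace_scale)
qed

lemma continuous_map_prod_fst_snd:
  "continuous_map T X f \<Longrightarrow> continuous_map (prod_topology T Y) X (\<lambda>p. f (fst p))"
  "continuous_map T X f \<Longrightarrow> continuous_map (prod_topology Y T) X (\<lambda>p. f (snd p))"
  using continuous_map_compose[OF continuous_map_fst, of T X f Y]
    continuous_map_compose[OF continuous_map_snd, of T X f Y] by (simp_all add: o_def)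


section \<open>Quotients and topological splittings\<close>

text \<open>Preimages under \<open>q\<close> commute with intersections and unions, so the condition
  in \<open>quot_topology\<close> does define a topology; only then does \<open>openin\<close>
  unfold to it.\<close>

lemma topspace_openin_quot:
  shows "openin (quot_topology T q) U \<longleftrightarrow>
      U \<subseteq> q ` topspace T \<and> openin T {x \<in> topspace T. q x \<in> U}"
    and "topspace (quot_topology T q) = q ` topspace T"
proof -
  have "istopology (\<lambda>U. U \<subseteq> q ` topspace T \<and> openin T {x \<in> topspace T. q x \<in> U})"
    unfolding istopology_def
  proof (intro conjI allI impI)
    fix S U assume "S \<subseteq> q ` topspace T \<and> openin T {x \<in> topspace T. q x \<in> S}"
      "U \<subseteq> q ` topspace T \<and> openin T {x \<in> topspace T. q x \<in> U}"
    moreover have "{x \<in> topspace T. q x \<in> S \<inter> U} =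
        {x \<in> topspace T. q x \<in> S} \<inter> {x \<in> topspace T. q x \<in> U}" by auto
    ultimately show "S \<inter> U \<subseteq> q ` topspace T" "openin T {x \<in> topspace T. q x \<in> S \<inter> U}"
      by auto
  next
    fix \<U> assume U: "\<forall>U\<in>\<U>. U \<subseteq> q ` topspace T \<and> openin T {x \<in> topspace T. q x \<in> U}"
    have "{x \<in> topspace T. q x \<in> \<Union>\<U>} = (\<Union>U\<in>\<U>. {x \<in> topspace T. q x \<in> U})" by auto
    then show "\<Union>\<U> \<subseteq> q ` topspace T" "openin T {x \<in> topspace T. q x \<in> \<Union>\<U>}"
      using U by auto
  qed
  then show *: "openin (quot_topology T q) U \<longleftrightarrow>
      U \<subseteq> q ` topspace T \<and> openin T {x \<in> topspace T. q x \<in> U}" for U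
    by (simp add: quot_topology_def)
  have e: "{x \<in> topspace T. q x \<in> q ` topspace T} = topspace T" by auto
  show "topspace (quot_topology T q) = q ` topspace T"
  proof
    show "topspace (quot_topology T q) \<subseteq> q ` topspace T"
      using openin_topspace[of "quot_topology T q"] unfolding * by blast
    show "q ` topspace T \<subseteq> topspace (quot_topology T q)"
      by (rule openin_subset) (simp add: * e)
  qed
qed

lemma quotient_map_quot_topology: "quotient_map T (quot_topology T q) q"
  by (simp add: quotient_map_def topspace_openin_quot)

lemma coset_eq_iff:
  assumes V: "topological_vector_space K V" and W: "module.subspace (vscale V) W"
  shows "x +o W = y +o W \<longleftrightarrow> x - y \<in> W"
proof -
  interpret module "vscale V" by (rule tvs_module[OF V])
  show ?thesis
  proof
    assume "x +o W = y +o W"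
    moreover have "x \<in> x +o W" using subspace_0[OF W] by (auto simp: elt_set_plus_def)
    ultimately show "x - y \<in> W" by (auto simp: elt_set_plus_def)
  next
    assume d: "x - y \<in> W"
    have "x + w \<in> y +o W" if "w \<in> W" for w
      using subspace_add[OF W d that] unfolding elt_set_plus_def
      by (intro CollectI bexI[of _ "x - y + w"]) auto
    moreover have "y + w \<in> x +o W" if "w \<in> W" for w
      using subspace_diff[OF W that d] unfolding elt_set_plus_def
      by (intro CollectI bexI[of _ "w - (x - y)"]) auto
    ultimately show "x +o W = y +o W" by (auto simp: elt_set_plus_def)
  qed
qed

lemma quot_simps:
  assumes V: "topological_vector_space K V" and W: "module.subspace (vscale V) W" "W \<subseteq> carr V"
  shows "carr (quot_tvs V W) = (\<lambda>x. x +o W) ` carr V"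
    and "(x +o W) + (y +o W) = (x + y) +o W"
    and "vscale (quot_tvs V W) c (x +o W) = vscale V c x +o W"
    and "quotient_map (vtop V) (vtop (quot_tvs V W)) (\<lambda>x. x +o W)"
    and "x \<in> x +o W"
proof -
  interpret module "vscale V" by (rule tvs_module[OF V])
  note eq = coset_eq_iff[OF V W(1)]
  show "carr (quot_tvs V W) = (\<lambda>x. x +o W) ` carr V"
    by (simp add: quot_tvs_def topspace_openin_quot)
  \<comment> \<open>Adding two cosets as sets yields the translate of \<open>W + W\<close> by
    \<open>x + y\<close>.\<close>
  have "W + W = W"
    using subspace_add[OF W(1)] subspace_0[OF W(1)] by (force simp: set_plus_def)
  then show "(x +o W) + (y +o W) = (x + y) +o W"
    by (simp add: set_plus_rearrange)
  show "x \<in> x +o W"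
    using subspace_0[OF W(1)] by (auto simp: elt_set_plus_def)
  \<comment> \<open>The union defining the scaled coset has equal members: multiples of two
    representatives differ by an element of \<open>W\<close>.\<close>
  have c: "vscale V c y +o W = vscale V c x +o W" if "y \<in> x +o W" for y
  proof -
    from that have "y - x \<in> W" by (rule set_plus_imp_minus)
    from subspace_scale[OF W(1) this, of c] show ?thesis
      by (simp only: eq scale_right_diff_distrib)
  qed
  have "x +o W \<noteq> {}" using \<open>x \<in> x +o W\<close> by blast
  from SUP_eq_const[OF this c]
  show "vscale (quot_tvs V W) c (x +o W) = vscale V c x +o W"
    by (simp only: quot_tvs_def tvs.simps)
  show "quotient_map (vtop V) (vtop (quot_tvs V W)) (\<lambda>x. x +o W)"
    by (simp add: quot_tvs_def quotient_map_quot_topology)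
qed

lemma linear_map_quot:
  assumes V: "topological_vector_space K V" and W: "module.subspace (vscale V) W" "W \<subseteq> carr V"
  shows "continuous_linear V (quot_tvs V W) (\<lambda>x. x +o W)"
  using quot_simps[OF assms] by (auto simp: linear_map_def quotient_imp_continuous_map)

text \<open>Later arguments use a splitting through the continuous projection
  \<open>x \<mapsto> x - \<sigma> (x +o W)\<close> onto \<open>W\<close> rather than through the
  homeomorphism with a product.\<close>

lemma topologically_split_projection:
  assumes K: "topspace K = UNIV" and V: "topological_vector_space K V"
    and split: "topologically_split V W"
  obtains P \<sigma> where "continuous_linear V (sub V W) P" "\<And>w. w \<in> W \<Longrightarrow> P w = w"
    and "continuous_linear (quot_tvs V W) V \<sigma>" "\<And>x. \<sigma> (x +o W) = x - P x"
proof -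
  from split obtain \<sigma> where W: "W \<subseteq> carr V" "module.subspace (vscale V) W"
    and lin: "linear_map (quot_tvs V W) V \<sigma>"
    and cont: "continuous_map (vtop (quot_tvs V W)) (vtop V) \<sigma>"
    and sec: "\<And>X. X \<in> carr (quot_tvs V W) \<Longrightarrow> \<sigma> X +o W = X"
    unfolding topologically_split_def by auto
  note q = quot_simps[OF V W(2,1)] and lq = linear_map_quot[OF V W(2,1)]
  note [simp] = tvs_simps[OF V]
  define P where "P x = x - \<sigma> (x +o W)" for x
  have l: "linear_map V V (\<lambda>x. \<sigma> (x +o W))"
    using linear_map_comp[OF conjunct1[OF lq] lin] by simp
  have "continuous_map (vtop V) (vtop V) (\<lambda>x. \<sigma> (x +o W))"
    using continuous_map_compose[OF conjunct2[OF lq] cont] by (simp add: o_def)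
  then have Pc: "continuous_map (vtop V) (vtop V) P"
    unfolding P_def using continuous_map_tvs_diff[OF K V continuous_map_id[unfolded id_def]] by auto
  have "linear_map V V (\<lambda>x. x)" by (simp add: linear_map_def)
  from linear_map_diff[OF V this l] have Pl: "linear_map V V P" unfolding P_def .
  have PW: "P x \<in> W" if "x \<in> carr V" for x
  proof -
    \<comment> \<open>\<open>\<sigma>\<close> picks a representative of each coset, so
      \<open>x\<close> and \<open>\<sigma> (x +o W)\<close> differ by an element of
      \<open>W\<close>.\<close>
    have "\<sigma> (x +o W) +o W = x +o W" using that sec q(1) by auto
    then show ?thesis unfolding P_def using coset_eq_iff[OF V W(2)] by metis
  qed
  have "P w = w" if "w \<in> W" for w
  proof -
    have "w +o W = 0 +o W" using that coset_eq_iff[OF V W(2), of w 0] by simp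
    then have "\<sigma> (w +o W) = \<sigma> (0 +o W)" by simp
    also have "\<dots> = 0" using linear_map_simps(5)[OF V l] .
    finally show ?thesis by (simp add: P_def)
  qed
  moreover have "continuous_linear V (sub V W) P"
    using Pl Pc PW W(1) by (auto simp: linear_map_def continuous_map_in_subtopology)
  moreover have "\<sigma> (x +o W) = x - P x" for x by (simp add: P_def)
  ultimately show ?thesis using that lin cont by blast
qed

text \<open>Converse of \<open>topologically_split_projection\<close>: the section sends
  \<open>x +o W\<close> to \<open>x - P x\<close>, which is independent of the representative since
  \<open>P\<close> is the identity on \<open>W\<close>.\<close>

lemma projection_topologically_split:
  assumes K: "topspace K = UNIV" and V: "topological_vector_space K V"
    and W: "module.subspace (vscale V) W" "W \<subseteq> carr V"
    and P: "continuous_linear V (sub V W) P" and id: "\<And>w. w \<in> W \<Longrightarrow> P w = w"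
  shows "topologically_split V W"
proof -
  note q = quot_simps[OF V W] and lq = linear_map_quot[OF V W]
  note [simp] = tvs_simps[OF V]
  note eq = coset_eq_iff[OF V W(1)]
  have PW: "P x \<in> W" if "x \<in> carr V" for x
    using P that W by (auto simp: linear_map_def)
  note [simp] = linear_map_simps[OF V conjunct1[OF P]]
  have Pc: "continuous_map (vtop V) (vtop V) P"
    using P continuous_map_into_fulltopology by auto
  define \<sigma> where "\<sigma> X = (let x = SOME x. x \<in> carr V \<and> X = x +o W in x - P x)" for X
  have s: "\<sigma> (x +o W) = x - P x" if "x \<in> carr V" for x
  proof -
    \<comment> \<open>The representative selected by \<open>SOME\<close> need not be
      \<open>x\<close>; the two differ by an element of \<open>W\<close>, which \<open>P\<close>
      fixes.\<close>
    define y where "y = (SOME y. y \<in> carr V \<and> x +o W = y +o W)"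
    have y: "y \<in> carr V" "x +o W = y +o W"
      using someI[of "\<lambda>y. y \<in> carr V \<and> x +o W = y +o W" x] that unfolding y_def by auto
    then have "x - y = P (x - y)" using id eq by metis
    then have "x - P x = y - P y" using y(1) that by (simp add: algebra_simps)
    then show ?thesis unfolding \<sigma>_def y_def by (simp add: Let_def)
  qed
  have lin: "linear_map (quot_tvs V W) V \<sigma>"
    by (rule linear_mapI) (use PW W in \<open>auto simp: q s subset_iff\<close>)
  \<comment> \<open>\<open>\<sigma>\<close> composed with the coset map is
    \<open>x \<mapsto> x - P x\<close>, so its continuity descends along the quotient map.\<close>
  have "continuous_map (vtop V) (vtop V) (\<lambda>x. x - P x)"
    using continuous_map_tvs_diff[OF K V continuous_map_id[unfolded id_def] Pc] by simp
  then have "continuous_map (vtop V) (vtop V) (\<sigma> \<circ> (\<lambda>x. x +o W))"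
    by (rule continuous_map_eq) (simp add: s)
  then have cont: "continuous_map (vtop (quot_tvs V W)) (vtop V) \<sigma>"
    using continuous_compose_quotient_map[OF q(4)] by blast
  have sec: "\<sigma> X +o W = X" if X: "X \<in> carr (quot_tvs V W)" for X
  proof -
    obtain x where x: "x \<in> carr V" "X = x +o W" using X q(1) by auto
    then show ?thesis
      using PW[of x] module.subspace_neg[OF tvs_module[OF V] W(1)] by (simp add: s eq)
  qed
  \<comment> \<open>\<open>W\<close> is the fixed point set of \<open>P\<close>, and two continuous
    maps into a Hausdorff space agree on a closed set.\<close>
  have "closedin (vtop V) {x \<in> topspace (vtop V). P x = x}"
    using V by (intro closedin_continuous_maps_eq[OF _ Pc continuous_map_id[unfolded id_def]])
      (simp add: topological_vector_space_def)
  moreover have "{x \<in> topspace (vtop V). P x = x} = W"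
    (is "?S = W")
  proof
    show "?S \<subseteq> W" using PW by force
    show "W \<subseteq> ?S" using id W(2) by blast
  qed
  ultimately have cl: "closedin (vtop V) W" by simp
  let ?X = "prod_topology (subtopology (vtop V) W) (vtop (quot_tvs V W))"
  have "continuous_map ?X (vtop V) (\<lambda>p. fst p + \<sigma> (snd p))"
    by (intro continuous_map_tvs_add[OF V] continuous_map_prod_fst_snd cont)
      (simp add: continuous_map_from_subtopology)
  \<comment> \<open>The inverse of the sum map separates \<open>x\<close> into its
    \<open>W\<close>-component and its coset.\<close>
  moreover have "continuous_map (vtop V) ?X (\<lambda>x. (P x, x +o W))"
    using P lq by (auto intro: continuous_map_pairedI)
  moreover have "P (w + \<sigma> X) = w" "(w + \<sigma> X) +o W = X"
    if w: "w \<in> W" "X \<in> carr (quot_tvs V W)" for w X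
  proof -
    obtain x where x: "x \<in> carr V" "X = x +o W" using w q(1) by auto
    have "P (P x) = P x" using PW id x by blast
    then show "P (w + \<sigma> X) = w"
      using w x W(2) PW[OF x(1)] by (auto simp: s id subset_iff)
    show "(w + \<sigma> X) +o W = X"
      using w x PW[OF x(1)] module.subspace_diff[OF tvs_module[OF V] W(1)] by (simp add: s eq)
  qed
  moreover have "P x + \<sigma> (x +o W) = x" if "x \<in> carr V" for x using that by (simp add: s)
  ultimately have "homeomorphic_maps ?X (vtop V) (\<lambda>(w, X). w + \<sigma> X) (\<lambda>x. (P x, x +o W))"
    unfolding homeomorphic_maps_def case_prod_unfold by auto
  then have "homeomorphic_map ?X (vtop V) (\<lambda>(w, X). w + \<sigma> X)"
    using homeomorphic_map_maps by blast
  with W lin cont sec cl show ?thesis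
    unfolding topologically_split_def by blast
qed

section \<open>Cochains of low degree\<close>

lemma tuples_iff:
  "xs \<in> tuples L 2 \<longleftrightarrow> (\<exists>x\<in>carr L. \<exists>y\<in>carr L. xs = [x, y])"
  "xs \<in> tuples L 3 \<longleftrightarrow> (\<exists>x\<in>carr L. \<exists>y\<in>carr L. \<exists>z\<in>carr L. xs = [x, y, z])"
  "xs \<in> tuples L 4 \<longleftrightarrow> (\<exists>x\<in>carr L. \<exists>y\<in>carr L. \<exists>z\<in>carr L. \<exists>w\<in>carr L. xs = [x, y, z, w])"
  by (auto simp: tuples_def length_Suc_conv eval_nat_numeral)

lemma map_upt_simps:
  "map f [0..<2] = [f 0, f 1]" "map f [0..<3] = [f 0, f 1, f 2]"
  by (simp_all add: eval_nat_numeral)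

text \<open>Reduces list cochains of degree two to bilinear maps on the binary product. The two
  descriptions use different product topologies, which are compared by explicit continuous
  maps.\<close>

lemma cochains2_iff:
  "\<omega> \<in> cochains L V 2 \<longleftrightarrow>
     continuous_bilinear L L V (\<lambda>x y. \<omega> [x, y]) \<and> (\<forall>x\<in>carr L. \<omega> [x, x] = 0)"
    (is "?l \<longleftrightarrow> ?r")
proof
  let ?P = "product_topology (\<lambda>_. vtop L) {..<2::nat}"
  assume l: ?l
  have lin: "linear_map L V (\<lambda>u. \<omega> ([x, y][i := u]))" if "x \<in> carr L" "y \<in> carr L" "i < 2" for x y i
  proof -
    have "[x, y] \<in> tuples L 2" using that by (simp add: tuples_iff)
    then show ?thesis using l that(3) unfolding cochains_def by blast
  qed
  have 1: "linear_map L V (\<lambda>u. \<omega> [x, u])" "linear_map L V (\<lambda>u. \<omega> [u, x])" if "x \<in> carr L" for x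
    using lin[OF that that, of 1] lin[OF that that, of 0] by simp_all
  have 2: "\<omega> [x, x] = 0" if "x \<in> carr L" for x
  proof -
    have "[x, x] \<in> tuples L 2" using that by (simp add: tuples_iff)
    with l have "\<forall>i<2. \<forall>j<2. i \<noteq> j \<longrightarrow> [x, x] ! i = [x, x] ! j \<longrightarrow> \<omega> [x, x] = 0"
      unfolding cochains_def by blast
    from this[rule_format, of 0 1] show ?thesis by simp
  qed
  have "continuous_map ?P (vtop V) (\<lambda>x. \<omega> [x 0, x 1])"
    using l by (simp add: cochains_def map_upt_simps)
  \<comment> \<open>A pair becomes a function on \<open>{..<2}\<close>; it is restricted to this set
    because points of \<open>product_topology\<close> are extensional.\<close>
  moreover have "continuous_map (prod_topology (vtop L) (vtop L)) ?P
      (\<lambda>p. \<lambda>i\<in>{..<2}. if i = 0 then fst p else snd p)"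
    by (auto simp: continuous_map_componentwise continuous_map_fst continuous_map_snd)
  ultimately have "continuous_map (prod_topology (vtop L) (vtop L)) (vtop V)
      ((\<lambda>x. \<omega> [x 0, x 1]) \<circ> (\<lambda>p. \<lambda>i\<in>{..<2::nat}. if i = 0 then fst p else snd p))"
    using continuous_map_compose by blast
  then show ?r
    using 1 2 by (simp add: continuous_bilinear_def bilinear_map_def o_def case_prod_unfold)
next
  assume r: ?r
  then have b: "continuous_bilinear L L V (\<lambda>x y. \<omega> [x, y])" and a: "\<And>x. x \<in> carr L \<Longrightarrow> \<omega> [x, x] = 0"
    by auto
  note l = bilinear_mapD[of L L V "\<lambda>x y. \<omega> [x, y]"]
  have "linear_map L V (\<lambda>x. \<omega> (xs[i := x]))" if "xs \<in> tuples L 2" "i < 2" for xs i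
    using that b l by (auto simp: tuples_iff less_2_cases_iff continuous_bilinear_def)
  moreover have "\<omega> xs = 0" if "xs \<in> tuples L 2" "i < 2" "j < 2" "i \<noteq> j" "xs ! i = xs ! j" for xs i j
    using that a by (auto simp: tuples_iff less_2_cases_iff)
  moreover have "continuous_map (product_topology (\<lambda>_. vtop L) {..<2::nat}) (vtop V)
      (\<lambda>x. \<omega> [x 0, x 1])"
    by (rule continuous_bilinear_compose[OF b]) (rule continuous_map_product_projection, simp)+
  ultimately show ?l
    by (auto simp: cochains_def map_upt_simps)
qed

lemma cochains3I:
  assumes "\<And>y z. y \<in> carr L \<Longrightarrow> z \<in> carr L \<Longrightarrow> linear_map L V (\<lambda>x. \<omega> [x, y, z])"
    and "\<And>y z. y \<in> carr L \<Longrightarrow> z \<in> carr L \<Longrightarrow> linear_map L V (\<lambda>x. \<omega> [y, x, z])"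
    and "\<And>y z. y \<in> carr L \<Longrightarrow> z \<in> carr L \<Longrightarrow> linear_map L V (\<lambda>x. \<omega> [y, z, x])"
    and "\<And>x y. x \<in> carr L \<Longrightarrow> y \<in> carr L \<Longrightarrow> \<omega> [x, x, y] = 0 \<and> \<omega> [x, y, x] = 0 \<and> \<omega> [y, x, x] = 0"
    and "continuous_map (product_topology (\<lambda>_. vtop L) {..<3::nat}) (vtop V) (\<lambda>u. \<omega> [u 0, u 1, u 2])"
  shows "\<omega> \<in> cochains L V 3"
proof -
  have 3: "i < 3 \<longleftrightarrow> i = 0 \<or> i = 1 \<or> i = (2::nat)" for i by auto
  have "linear_map L V (\<lambda>x. \<omega> (xs[i := x]))" if "xs \<in> tuples L 3" "i < 3" for xs i
    using that assms(1-3) by (auto simp: tuples_iff 3)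
  moreover have "\<omega> xs = 0" if "xs \<in> tuples L 3" "i < 3" "j < 3" "i \<noteq> j" "xs ! i = xs ! j" for xs i j
    using that assms(4) by (auto simp: tuples_iff 3)
  ultimately show ?thesis
    using assms(5) by (auto simp: cochains_def map_upt_simps)
qed

lemma cochains_diff:
  assumes K: "topspace K = UNIV" and V: "topological_vector_space K V"
    and "\<omega> \<in> cochains L V p" "\<omega>' \<in> cochains L V p"
  shows "(\<lambda>xs. \<omega> xs - \<omega>' xs) \<in> cochains L V p"
  using assms(3,4) unfolding cochains_def
  by (auto intro!: linear_map_diff[OF V] continuous_map_tvs_diff[OF K V])

lemma cochains_zero:
  assumes V: "topological_vector_space K V"
  shows "(\<lambda>xs. 0) \<in> cochains L V p"
  by (auto simp: cochains_def tvs_simps[OF V] intro!: linear_map_zero[OF V])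

lemma cochains_pullback:
  assumes t: "continuous_linear L M t" and \<omega>: "\<omega> \<in> cochains M V p"
  shows "(\<lambda>xs. \<omega> (map t xs)) \<in> cochains L V p"
proof -
  have tup: "map t xs \<in> tuples M p" if "xs \<in> tuples L p" for xs
    using that t by (auto simp: tuples_def linear_map_def)
  have "linear_map L V (\<lambda>x. \<omega> (map t (xs[i := x])))" if "xs \<in> tuples L p" "i < p" for xs i
    unfolding map_update
    by (rule linear_map_comp[OF conjunct1[OF t]]) (use \<omega> tup[OF that(1)] that(2) in \<open>simp add: cochains_def\<close>)
  moreover have "\<omega> (map t xs) = 0"
    if "xs \<in> tuples L p" "i < p" "j < p" "i \<noteq> j" "xs ! i = xs ! j" for xs i j
  proof -
    have "length xs = p" using that(1) by (simp add: tuples_def)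
    then have "map t xs ! i = map t xs ! j" using that by simp
    then show ?thesis using \<omega> tup[OF that(1)] that(2-4) unfolding cochains_def by blast
  qed
  moreover have "continuous_map (product_topology (\<lambda>_. vtop L) {..<p}) (vtop V)
      (\<lambda>x. \<omega> (map t (map x [0..<p])))"
  proof -
    \<comment> \<open>The restriction to \<open>{..<p}\<close> makes the coordinatewise map land in
      the extensional product; entries outside are never read.\<close>
    have "continuous_map (product_topology (\<lambda>_. vtop L) {..<p}) (product_topology (\<lambda>_. vtop M) {..<p})
       (\<lambda>x. \<lambda>i\<in>{..<p}. t (x i))"
    proof -
      have "continuous_map (product_topology (\<lambda>_. vtop L) {..<p}) (vtop M) (\<lambda>x. t (x i))" if "i < p" for i
      proof -
        have "continuous_map (product_topology (\<lambda>_. vtop L) {..<p}) (vtop L) (\<lambda>x. x i)"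
          by (rule continuous_map_product_projection) (simp add: that)
        from continuous_map_compose[OF this conjunct2[OF t]] show ?thesis by (simp add: o_def)
      qed
      then show ?thesis by (auto simp: continuous_map_componentwise)
    qed
    moreover have "continuous_map (product_topology (\<lambda>_. vtop M) {..<p}) (vtop V) (\<lambda>x. \<omega> (map x [0..<p]))"
      using \<omega> by (simp add: cochains_def)
    ultimately have "continuous_map (product_topology (\<lambda>_. vtop L) {..<p}) (vtop V)
        ((\<lambda>x. \<omega> (map x [0..<p])) \<circ> (\<lambda>x. \<lambda>i\<in>{..<p}. t (x i)))"
      by (rule continuous_map_compose)
    moreover have "map (\<lambda>i\<in>{..<p}. t (x i)) [0..<p] = map t (map x [0..<p])" for x
      by simp
    ultimately show ?thesis by (simp add: o_def)
  qed
  ultimately show ?thesis by (auto simp: cochains_def)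
qed

section \<open>The differential in degrees two and three\<close>

lemma differential2:
  assumes V: "topological_vector_space K V"
  shows "differential L V \<rho> \<omega> [x, y, z] =
     \<rho> x (\<omega> [y, z]) - \<rho> y (\<omega> [x, z]) + \<rho> z (\<omega> [x, y])
     - \<omega> [lbr L x y, z] + \<omega> [lbr L x z, y] - \<omega> [lbr L y z, x]"
  by (simp add: differential_def del_def lessThan_Suc eval_nat_numeral tvs_simps[OF V])

lemma differential3:
  assumes V: "topological_vector_space K V"
  shows "differential L V \<rho> \<omega> [x, y, z, w] =
     \<rho> x (\<omega> [y, z, w]) - \<rho> y (\<omega> [x, z, w]) + \<rho> z (\<omega> [x, y, w]) - \<rho> w (\<omega> [x, y, z])
     - \<omega> [lbr L x y, z, w] + \<omega> [lbr L x z, y, w] - \<omega> [lbr L x w, y, z]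
     - \<omega> [lbr L y z, x, w] + \<omega> [lbr L y w, x, z] - \<omega> [lbr L z w, x, y]"
  by (simp add: differential_def del_def lessThan_Suc eval_nat_numeral tvs_simps[OF V])

lemma tla_tvs: "topological_lie_algebra K L \<Longrightarrow> topological_vector_space K L"
  by (simp add: topological_lie_algebra_def)

lemma tla_bilinear: "topological_lie_algebra K L \<Longrightarrow> bilinear_map L L L (lbr L)"
  by (simp add: topological_lie_algebra_def continuous_bilinear_def)

lemma lbr_antisym:
  assumes "topological_lie_algebra K L" "x \<in> carr L" "y \<in> carr L"
  shows "lbr L y x = - lbr L x y"
  using alternating_antisym[OF tla_tvs[OF assms(1)] tla_bilinear[OF assms(1)] _ assms(2,3)] assms(1)
  by (simp add: topological_lie_algebra_def)

text \<open>The Jacobi identity solved for one nested bracket, with inner brackets always in the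
  first slot: the shape in which nested brackets enter the iterated differential.\<close>

lemma lbr_jacobi:
  assumes L: "topological_lie_algebra K L" and x: "x \<in> carr L" "y \<in> carr L" "z \<in> carr L"
  shows "lbr L (lbr L x y) z = lbr L (lbr L x z) y - lbr L (lbr L y z) x"
proof -
  note [simp] = tvs_simps[OF tla_tvs[OF L]]
    bilinear_simps[OF tla_tvs[OF L] tla_tvs[OF L] tla_bilinear[OF L]]
  have "lbr L x (lbr L y z) + lbr L y (lbr L z x) + lbr L z (lbr L x y) = 0"
    using L x by (simp add: topological_lie_algebra_def)
  moreover have "lbr L x (lbr L y z) = - lbr L (lbr L y z) x" "lbr L z (lbr L x y) = - lbr L (lbr L x y) z"
    "lbr L y (lbr L z x) = lbr L (lbr L x z) y"
    using lbr_antisym[OF L, of x z] lbr_antisym[OF L, of "lbr L y z" x]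
      lbr_antisym[OF L, of "lbr L x y" z] lbr_antisym[OF L, of "lbr L x z" y] x by simp_all
  ultimately show ?thesis by (simp add: algebra_simps)
qed

lemma tm_tvs: "topological_module K L V \<rho> \<Longrightarrow> topological_vector_space K V"
  by (simp add: topological_module_def)

lemma tm_bilinear: "topological_module K L V \<rho> \<Longrightarrow> bilinear_map L V V \<rho>"
  by (simp add: topological_module_def continuous_bilinear_def)

text \<open>\<open>d \<circ> d = 0\<close> by expansion: iterated actions cancel by the module
  identity, nested brackets by Jacobi, and terms with two disjoint brackets by antisymmetry of
  \<open>F\<close>.\<close>

lemma differential_differential2:
  assumes L: "topological_lie_algebra K L" and M: "topological_module K L V \<rho>"
    and F: "F \<in> cochains L V 2"
    and x: "x \<in> carr L" "y \<in> carr L" "z \<in> carr L" "w \<in> carr L"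
  shows "differential L V \<rho> (differential L V \<rho> F) [x, y, z, w] = 0"
proof -
  have b: "bilinear_map L L V (\<lambda>x y. F [x, y])" and a: "\<And>x. x \<in> carr L \<Longrightarrow> F [x, x] = 0"
    using F by (auto simp: cochains2_iff continuous_bilinear_def)
  note tL = tla_tvs[OF L] and tV = tm_tvs[OF M]
  note [simp] = tvs_simps[OF tL] tvs_simps[OF tV] bilinear_simps[OF tL tL tla_bilinear[OF L]]
    bilinear_simps[OF tL tV tm_bilinear[OF M]] bilinear_simps[OF tL tL b]
  have m: "\<rho> (lbr L x y) v = \<rho> x (\<rho> y v) - \<rho> y (\<rho> x v)"
    if "x \<in> carr L" "y \<in> carr L" "v \<in> carr V" for x y v
    using M that by (simp add: topological_module_def)
  have s: "F [y, x] = - F [x, y]" if "x \<in> carr L" "y \<in> carr L" for x y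
    using that by (intro alternating_antisym[OF tL b]) (auto intro: a)
  \<comment> \<open>The three ways to split the four arguments into two pairs; each occurs in both
    orders.\<close>
  have s': "F [lbr L z w, lbr L x y] = - F [lbr L x y, lbr L z w]"
    "F [lbr L y w, lbr L x z] = - F [lbr L x z, lbr L y w]"
    "F [lbr L x w, lbr L y z] = - F [lbr L y z, lbr L x w]"
    using x by (intro s; simp)+
  note j = lbr_jacobi[OF L x(1,2,3)] lbr_jacobi[OF L x(1,2,4)] lbr_jacobi[OF L x(1,3,4)]
    lbr_jacobi[OF L x(2,3,4)]
  show ?thesis
    using x by (simp add: differential2[OF tV] differential3[OF tV] m s' j)
qed

lemma differential_cochain2:
  assumes K: "topspace K = UNIV"
    and L: "topological_lie_algebra K L" and M: "topological_module K L V \<rho>"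
    and F: "F \<in> cochains L V 2"
  shows "differential L V \<rho> F \<in> cochains L V 3"
proof -
  have Fb: "continuous_bilinear L L V (\<lambda>x y. F [x, y])"
    using F by (simp add: cochains2_iff)
  have b: "bilinear_map L L V (\<lambda>x y. F [x, y])" and a: "\<And>x. x \<in> carr L \<Longrightarrow> F [x, x] = 0"
    using F by (auto simp: cochains2_iff continuous_bilinear_def)
  have lb: "continuous_bilinear L L L (lbr L)" and rb: "continuous_bilinear L V V \<rho>"
    using L M by (simp_all add: topological_lie_algebra_def topological_module_def)
  note tL = tla_tvs[OF L] and tV = tm_tvs[OF M]
  have aL: "lbr L x x = 0" if "x \<in> carr L" for x using L that by (simp add: topological_lie_algebra_def)
  note simps = tvs_simps[OF tL] tvs_simps[OF tV] bilinear_simps[OF tL tL tla_bilinear[OF L]]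
    bilinear_simps[OF tL tV tm_bilinear[OF M]] bilinear_simps[OF tL tL b]
  note [simp] = simps
  have s: "F [y, x] = - F [x, y]" if "x \<in> carr L" "y \<in> carr L" for x y
    using that by (intro alternating_antisym[OF tL b]) (auto intro: a)
  show ?thesis
  proof (rule cochains3I)
    show "linear_map L V (\<lambda>x. differential L V \<rho> F [x, y, z])"
      "linear_map L V (\<lambda>x. differential L V \<rho> F [y, x, z])"
      "linear_map L V (\<lambda>x. differential L V \<rho> F [y, z, x])" if "y \<in> carr L" "z \<in> carr L" for y z
      using that by (auto intro!: linear_mapI simp: differential2[OF tV])
  next
    fix x y assume x: "x \<in> carr L" "y \<in> carr L"
    show "differential L V \<rho> F [x, x, y] = 0 \<and> differential L V \<rho> F [x, y, x] = 0 \<and>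
        differential L V \<rho> F [y, x, x] = 0"
      using x by (simp add: differential2[OF tV] a aL s[OF x] lbr_antisym[OF L x])
  next
    let ?P = "product_topology (\<lambda>_. vtop L) {..<3::nat}"
    have p: "continuous_map ?P (vtop L) (\<lambda>u. u i)" if "i < 3" for i
      by (rule continuous_map_product_projection) (simp add: that)
    note c = continuous_bilinear_compose[OF Fb] continuous_bilinear_compose[OF lb]
      continuous_bilinear_compose[OF rb]
    show "continuous_map ?P (vtop V) (\<lambda>u. differential L V \<rho> F [u 0, u 1, u 2])"
      unfolding differential2[OF tV]
      by (intro continuous_map_tvs_diff[OF K tV] continuous_map_tvs_add[OF tV] c p) simp_all
  qed
qed

section \<open>Split abelian extensions and two-cocycles\<close>

lemma cocycle2D:
  assumes "f \<in> cocycles L V \<rho> 2" "topological_vector_space K V"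
  shows "f \<in> cochains L V 2"
    and "x \<in> carr L \<Longrightarrow> y \<in> carr L \<Longrightarrow> z \<in> carr L \<Longrightarrow>
      \<rho> x (f [y, z]) - \<rho> y (f [x, z]) + \<rho> z (f [x, y])
       - f [lbr L x y, z] + f [lbr L x z, y] - f [lbr L y z, x] = 0"
proof -
  show "f \<in> cochains L V 2" using assms(1) by (simp add: cocycles_def)
  assume "x \<in> carr L" "y \<in> carr L" "z \<in> carr L"
  then have "[x, y, z] \<in> tuples L 3" by (simp add: tuples_iff)
  then have "differential L V \<rho> f [x, y, z] = 0" using assms(1) by (simp add: cocycles_def)
  then show "\<rho> x (f [y, z]) - \<rho> y (f [x, z]) + \<rho> z (f [x, y])
       - f [lbr L x y, z] + f [lbr L x z, y] - f [lbr L y z, x] = 0"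
    by (simp only: differential2[OF assms(2)])
qed

text \<open>\<open>q\<close> identifies the quotient of \<open>E\<close> by the image of
  \<open>\<iota>\<close> with \<open>G\<close>, so the rule \<open>q e \<mapsto> e - P e\<close> is
  a section over \<open>G\<close>. It is applied below to \<open>\<alpha>\<close> over its image as
  well.\<close>

lemma split_extension_section:
  assumes K: "topspace K = UNIV" and ext: "split_abelian_extension K A \<rho> E G \<iota> q"
  obtains \<tau> where "continuous_linear G E \<tau>" "\<And>x. x \<in> carr G \<Longrightarrow> q (\<tau> x) = x"
proof -
  have E: "topological_vector_space K E" and split: "topologically_split E (\<iota> ` carr A)"
    and q: "linear_map E G q" "quotient_map (vtop E) (vtop G) q"
    and ker: "{e \<in> carr E. q e = 0} = \<iota> ` carr A"
    using ext by (auto simp: split_abelian_extension_def lie_morphism_def dest: tla_tvs)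
  obtain P where P: "continuous_linear E (sub E (\<iota> ` carr A)) P" "\<And>w. w \<in> \<iota> ` carr A \<Longrightarrow> P w = w"
    by (rule topologically_split_projection[OF K E split], rule that)
  have P_in: "P e \<in> carr E" "q (P e) = 0" if "e \<in> carr E" for e
    using linear_map_in[OF conjunct1[OF P(1)] that] ker by auto
  note [simp] = tvs_simps[OF E] linear_map_simps[OF E q(1)] linear_map_simps[OF E conjunct1[OF P(1)]] P_in
  \<comment> \<open>\<open>inv_into\<close> picks some preimage of \<open>x\<close>. Two preimages
    differ by an element of the image of \<open>\<iota>\<close>, where \<open>P\<close> is the
    identity, so the value does not depend on the choice.\<close>
  define \<tau> where "\<tau> x = (let e = inv_into (carr E) q x in e - P e)" for x
  have surj: "q ` carr E = carr G" using q(2) by (simp add: quotient_map_def)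
  have \<tau>: "\<tau> (q e) = e - P e" if e: "e \<in> carr E" for e
  proof -
    define e' where "e' = inv_into (carr E) q (q e)"
    have e': "e' \<in> carr E" "q e' = q e"
      unfolding e'_def using e by (auto intro: inv_into_into f_inv_into_f)
    then have "e - e' \<in> \<iota> ` carr A" using e ker by force
    then have "P (e - e') = e - e'" by (rule P(2))
    then have "e' - P e' = e - P e" using e e' by (simp add: algebra_simps)
    then show ?thesis by (simp add: \<tau>_def e'_def Let_def)
  qed
  have rep: "\<exists>e\<in>carr E. x = q e" if "x \<in> carr G" for x using that surj by blast
  have "linear_map G E \<tau>"
  proof (rule linear_mapI)
    fix x assume "x \<in> carr G"
    then show "\<tau> x \<in> carr E" using rep \<tau> by fastforce
  next
    fix x y assume "x \<in> carr G" "y \<in> carr G"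
    then obtain e e' where e: "e \<in> carr E" "e' \<in> carr E" "x = q e" "y = q e'" using rep by blast
    then have "\<tau> (x + y) = \<tau> (q (e + e'))" by simp
    also have "\<dots> = \<tau> x + \<tau> y" using e \<tau> \<tau>[of "e + e'"] by (simp del: linear_map_simps(2))
    finally show "\<tau> (x + y) = \<tau> x + \<tau> y" .
  next
    fix c x assume "x \<in> carr G"
    then obtain e where e: "e \<in> carr E" "x = q e" using rep by blast
    then have "\<tau> (vscale G c x) = \<tau> (q (vscale E c e))" by simp
    also have "\<dots> = vscale E c (\<tau> x)" using \<tau>[of "vscale E c e"] e \<tau>[of e] by simp
    finally show "\<tau> (vscale G c x) = vscale E c (\<tau> x)" .
  qed
  \<comment> \<open>\<open>\<tau> \<circ> q\<close> is \<open>e \<mapsto> e - P e\<close> and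
    \<open>q\<close> is a quotient map, so continuity on \<open>E\<close> gives continuity on
    \<open>G\<close>.\<close>
  moreover have "continuous_map (vtop E) (vtop E) (\<lambda>e. e - P e)"
    using continuous_map_tvs_diff[OF K E continuous_map_id[unfolded id_def]] P(1)
    by (auto dest: continuous_map_into_fulltopology)
  then have "continuous_map (vtop E) (vtop E) (\<tau> \<circ> q)"
    by (rule continuous_map_eq) (simp add: \<tau>)
  then have "continuous_map (vtop G) (vtop E) \<tau>"
    by (rule continuous_compose_quotient_map[OF q(2)])
  moreover have "q (\<tau> x) = x" if "x \<in> carr G" for x
    using rep[OF that] by (auto simp: \<tau>)
  ultimately show ?thesis using that by blast
qed

text \<open>The failure \<open>c\<close> of \<open>\<tau>\<close> to be a Lie morphism is killed by
  \<open>q\<close>, hence has values in the image of \<open>\<iota>\<close>; the Jacobi identities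
  of \<open>E\<close> and \<open>G\<close> make it a two-cocycle.\<close>

lemma section_cocycle:
  assumes K: "topspace K = UNIV" and ext: "split_abelian_extension K A \<rho> E G \<iota> q"
    and G: "topological_lie_algebra K G" and M: "topological_module K G A \<rho>"
    and \<tau>: "continuous_linear G E \<tau>" "\<And>x. x \<in> carr G \<Longrightarrow> q (\<tau> x) = x"
  obtains f where "f \<in> cocycles G A \<rho> 2"
    "\<And>x y. x \<in> carr G \<Longrightarrow> y \<in> carr G \<Longrightarrow> \<iota> (f [x, y]) = lbr E (\<tau> x) (\<tau> y) - \<tau> (lbr G x y)"
proof -
  have EL: "topological_lie_algebra K E" and em: "embedding_map (vtop A) (vtop E) \<iota>"
    and \<iota>: "linear_map A E \<iota>" and q: "linear_map E G q"
    and ker: "{e \<in> carr E. q e = 0} = \<iota> ` carr A"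
    and q_lbr: "\<And>x y. x \<in> carr E \<Longrightarrow> y \<in> carr E \<Longrightarrow> q (lbr E x y) = lbr G (q x) (q y)"
    and ad: "\<And>e a. e \<in> carr E \<Longrightarrow> a \<in> carr A \<Longrightarrow> lbr E e (\<iota> a) = \<iota> (\<rho> (q e) a)"
    using ext by (auto simp: split_abelian_extension_def lie_morphism_def)
  note tE = tla_tvs[OF EL] and tA = tm_tvs[OF M] and tG = tla_tvs[OF G]
  note [simp] = tvs_simps[OF tE] tvs_simps[OF tA] tvs_simps[OF tG]
    linear_map_simps[OF tA \<iota>] linear_map_simps[OF tE q] linear_map_simps[OF tG conjunct1[OF \<tau>(1)]]
    bilinear_simps[OF tE tE tla_bilinear[OF EL]] bilinear_simps[OF tG tG tla_bilinear[OF G]]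
    bilinear_simps[OF tG tA tm_bilinear[OF M]] \<tau>(2)
  \<comment> \<open>\<open>r\<close> inverts \<open>\<iota>\<close> on its image; the embedding
    property makes it continuous, and with it the cochain \<open>f\<close>.\<close>
  obtain r where r: "homeomorphic_maps (vtop A) (subtopology (vtop E) (\<iota> ` carr A)) \<iota> r"
    using em unfolding embedding_map_def homeomorphic_map_maps by blast
  then have rc: "continuous_map (subtopology (vtop E) (\<iota> ` carr A)) (vtop A) r"
    and r\<iota>: "\<And>a. a \<in> carr A \<Longrightarrow> r (\<iota> a) = a"
    unfolding homeomorphic_maps_def by auto
  define c where "c x y = lbr E (\<tau> x) (\<tau> y) - \<tau> (lbr G x y)" for x y
  define f where "f xs = r (c (xs ! 0) (xs ! 1))" for xs
  have c_in: "c x y \<in> \<iota> ` carr A" if "x \<in> carr G" "y \<in> carr G" for x y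
  proof -
    have "c x y \<in> carr E" "q (c x y) = 0" using that by (simp_all add: c_def q_lbr)
    then show ?thesis using ker by blast
  qed
  have f_in: "f [x, y] \<in> carr A" and \<iota>f: "\<iota> (f [x, y]) = c x y"
    if "x \<in> carr G" "y \<in> carr G" for x y
    using c_in[OF that] r\<iota> by (auto simp: f_def)
  \<comment> \<open>Identities for \<open>f\<close> are checked after applying
    \<open>\<iota>\<close>, where they become identities for \<open>c\<close> inside
    \<open>E\<close>.\<close>
  have inj: "a = b" if "a \<in> carr A" "b \<in> carr A" "\<iota> a = \<iota> b" for a b
    using that r\<iota> by metis
  have G0: "lbr G x x = 0" if "x \<in> carr G" for x using G that by (simp add: topological_lie_algebra_def)
  have E0: "lbr E x x = 0" if "x \<in> carr E" for x using EL that by (simp add: topological_lie_algebra_def)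
  have "bilinear_map G G A (\<lambda>x y. f [x, y])"
    unfolding bilinear_map_def
  proof (intro conjI ballI linear_mapI)
    fix x y assume x: "x \<in> carr G" "y \<in> carr G"
    show "f [x, y] \<in> carr A" using f_in[OF x] .
    fix z assume z: "z \<in> carr G"
    show "f [x, y + z] = f [x, y] + f [x, z]"
      by (rule inj) (use x z f_in in \<open>simp_all add: \<iota>f, simp add: c_def algebra_simps\<close>)
    show "f [y + z, x] = f [y, x] + f [z, x]"
      by (rule inj) (use x z f_in in \<open>simp_all add: \<iota>f, simp add: c_def algebra_simps\<close>)
  next
    fix x y assume x: "x \<in> carr G" "y \<in> carr G"
    show "f [y, x] \<in> carr A" using f_in[OF x(2,1)] .
    fix k
    show "f [x, vscale G k y] = vscale A k (f [x, y])"
      by (rule inj) (use x f_in in \<open>simp_all add: \<iota>f, simp add: c_def\<close>)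
    show "f [vscale G k y, x] = vscale A k (f [y, x])"
      by (rule inj) (use x f_in in \<open>simp_all add: \<iota>f, simp add: c_def\<close>)
  qed
  moreover have "continuous_map (prod_topology (vtop G) (vtop G)) (vtop A) (\<lambda>p. f [fst p, snd p])"
  proof -
    let ?P = "prod_topology (vtop G) (vtop G)"
    have t: "continuous_map ?P (vtop E) (\<lambda>p. \<tau> (fst p))" "continuous_map ?P (vtop E) (\<lambda>p. \<tau> (snd p))"
      using continuous_map_prod_fst_snd[OF conjunct2[OF \<tau>(1)]] by auto
    have l: "continuous_bilinear E E E (lbr E)" "continuous_bilinear G G G (lbr G)"
      using EL G by (simp_all add: topological_lie_algebra_def)
    have "continuous_map ?P (vtop E) (\<lambda>p. \<tau> (lbr G (fst p) (snd p)))"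
      using continuous_map_compose[OF continuous_bilinear_compose[OF l(2) continuous_map_fst continuous_map_snd]
          conjunct2[OF \<tau>(1)]] by (simp add: o_def)
    from continuous_map_tvs_diff[OF K tE continuous_bilinear_compose[OF l(1) t] this]
    have "continuous_map ?P (vtop E) (\<lambda>p. c (fst p) (snd p))" unfolding c_def .
    then have "continuous_map ?P (subtopology (vtop E) (\<iota> ` carr A)) (\<lambda>p. c (fst p) (snd p))"
      using c_in by (auto simp: continuous_map_in_subtopology)
    from continuous_map_compose[OF this rc] show ?thesis by (simp add: o_def f_def)
  qed
  moreover have "f [x, x] = 0" if "x \<in> carr G" for x
    by (rule inj) (use that f_in in \<open>simp_all add: \<iota>f, simp add: c_def E0 G0\<close>)
  ultimately have fc: "f \<in> cochains G A 2"
    by (simp add: cochains2_iff continuous_bilinear_def case_prod_unfold)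
  have "differential G A \<rho> f [x, y, z] = 0" if x: "x \<in> carr G" "y \<in> carr G" "z \<in> carr G" for x y z
  proof (rule inj)
    show "differential G A \<rho> f [x, y, z] \<in> carr A"
      using x by (simp add: differential2[OF tA] f_in)
    \<comment> \<open>Because \<open>q (\<tau> x) = x\<close>, the module action of \<open>x\<close>
      becomes the bracket with \<open>\<tau> x\<close> in \<open>E\<close>.\<close>
    have \<iota>\<rho>: "\<iota> (\<rho> x (f [y, z])) = lbr E (\<tau> x) (c y z)" if "x \<in> carr G" "y \<in> carr G" "z \<in> carr G" for x y z
      using that by (simp add: ad f_in flip: \<iota>f)
    have t: "\<tau> x \<in> carr E" "\<tau> y \<in> carr E" "\<tau> z \<in> carr E" using x by simp_all
    have t2: "lbr E (\<tau> x) (\<tau> (lbr G y z)) = - lbr E (\<tau> (lbr G y z)) (\<tau> x)"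
      "lbr E (\<tau> y) (\<tau> (lbr G x z)) = - lbr E (\<tau> (lbr G x z)) (\<tau> y)"
      "lbr E (\<tau> z) (\<tau> (lbr G x y)) = - lbr E (\<tau> (lbr G x y)) (\<tau> z)"
      "lbr E (\<tau> x) (lbr E (\<tau> y) (\<tau> z)) = - lbr E (lbr E (\<tau> y) (\<tau> z)) (\<tau> x)"
      "lbr E (\<tau> y) (lbr E (\<tau> x) (\<tau> z)) = - lbr E (lbr E (\<tau> x) (\<tau> z)) (\<tau> y)"
      "lbr E (\<tau> z) (lbr E (\<tau> x) (\<tau> y)) = - lbr E (lbr E (\<tau> x) (\<tau> y)) (\<tau> z)"
      using x t by (intro lbr_antisym[OF EL]; simp)+
    show "\<iota> (differential G A \<rho> f [x, y, z]) = \<iota> 0"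
      using x by (simp add: differential2[OF tA] f_in \<iota>f \<iota>\<rho>)
        (simp add: c_def t2 lbr_jacobi[OF EL t] lbr_jacobi[OF G x])
  qed simp
  then have "f \<in> cocycles G A \<rho> 2"
    using fc by (auto simp: cocycles_def tuples_iff)
  then show ?thesis using that \<iota>f by (simp add: c_def)
qed

section \<open>Twisted sums\<close>

lemma twisted_sum_simps [simp]:
  "vtop (twisted_sum A L \<rho> f) = prod_topology (vtop A) (vtop L)"
  "vscale (twisted_sum A L \<rho> f) c p = (vscale A c (fst p), vscale L c (snd p))"
  "lbr (twisted_sum A L \<rho> f) p p' =
     (\<rho> (snd p) (fst p') - \<rho> (snd p') (fst p) + f [snd p, snd p'], lbr L (snd p) (snd p'))"
  by (simp_all add: twisted_sum_def case_prod_unfold)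

lemma tvs_twisted_sum:
  assumes A: "topological_vector_space K A" and L: "topological_vector_space K L"
  shows "topological_vector_space K (twisted_sum A L \<rho> f)"
proof -
  let ?E = "twisted_sum A L \<rho> f" and ?T = "prod_topology (vtop A) (vtop L)"
  have "vector_space (vscale A)" "vector_space (vscale L)"
    using A L by (simp_all add: topological_vector_space_def)
  then have v: "vector_space (vscale ?E)"
    by (simp add: vector_space_def prod_eq_iff)
  then interpret module "vscale ?E" by (simp add: vector_space_def Modules.module_def)
  have "subspace (carr ?E)"
    using A L by (auto intro!: subspaceI simp: tvs_simps mem_Times_iff)
  moreover have "Hausdorff_space ?T"
    using A L by (auto simp: topological_vector_space_def Hausdorff_space_prod_topology)
  moreover have "continuous_map (prod_topology ?T ?T) ?T (\<lambda>p. (fst (fst p) + fst (snd p), snd (fst p) + snd (snd p)))"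
    by (intro continuous_map_pairedI continuous_map_tvs_add[OF A] continuous_map_tvs_add[OF L]
        continuous_map_prod_fst_snd continuous_map_fst continuous_map_snd)
  then have "continuous_map (prod_topology ?T ?T) ?T (\<lambda>(p, p'). p + p')"
    by (simp add: case_prod_unfold plus_prod_def)
  moreover have "continuous_map (prod_topology K ?T) ?T
      (\<lambda>p. (vscale A (fst p) (fst (snd p)), vscale L (fst p) (snd (snd p))))"
    by (intro continuous_map_pairedI continuous_map_tvs_scale[OF A] continuous_map_tvs_scale[OF L]
        continuous_map_prod_fst_snd continuous_map_fst continuous_map_snd)
  ultimately show ?thesis
    using v by (simp add: topological_vector_space_def case_prod_unfold)
qed

text \<open>The second component of the Jacobi identity is that of \<open>L\<close>; the first
  follows from the module identity and the cocycle identity of \<open>f\<close>.\<close>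

lemma tla_twisted_sum:
  assumes K: "topspace K = UNIV" and L: "topological_lie_algebra K L"
    and M: "topological_module K L A \<rho>" and f: "f \<in> cocycles L A \<rho> 2"
  shows "topological_lie_algebra K (twisted_sum A L \<rho> f)"
proof -
  let ?E = "twisted_sum A L \<rho> f" and ?T = "prod_topology (vtop A) (vtop L)"
  note tL = tla_tvs[OF L] and tA = tm_tvs[OF M]
  have fc: "continuous_bilinear L L A (\<lambda>x y. f [x, y])" and f0: "\<And>x. x \<in> carr L \<Longrightarrow> f [x, x] = 0"
    using cocycle2D(1)[OF f tA] by (auto simp: cochains2_iff)
  then have b: "bilinear_map L L A (\<lambda>x y. f [x, y])" by (simp add: continuous_bilinear_def)
  note [simp] = tvs_simps[OF tL] tvs_simps[OF tA] bilinear_simps[OF tL tL tla_bilinear[OF L]]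
    bilinear_simps[OF tL tA tm_bilinear[OF M]] bilinear_simps[OF tL tL b]
  have s: "f [y, x] = - f [x, y]" if "x \<in> carr L" "y \<in> carr L" for x y
    using that by (intro alternating_antisym[OF tL b]) (auto intro: f0)
  have m: "\<rho> (lbr L x y) v = \<rho> x (\<rho> y v) - \<rho> y (\<rho> x v)"
    if "x \<in> carr L" "y \<in> carr L" "v \<in> carr A" for x y v
    using M that by (simp add: topological_module_def)
  have lc: "continuous_bilinear L L L (lbr L)" and rc: "continuous_bilinear L A A \<rho>"
    and L0: "\<And>x. x \<in> carr L \<Longrightarrow> lbr L x x = 0"
    using L M by (simp_all add: topological_lie_algebra_def topological_module_def)
  have "bilinear_map ?E ?E ?E (lbr ?E)"
    unfolding bilinear_map_def by (auto intro!: linear_mapI simp: algebra_simps)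
  moreover have "continuous_map (prod_topology ?T ?T) ?T (\<lambda>p. lbr ?E (fst p) (snd p))"
    unfolding twisted_sum_simps
    by (intro continuous_map_pairedI continuous_map_tvs_add[OF tA] continuous_map_tvs_diff[OF K tA]
        continuous_bilinear_compose[OF fc] continuous_bilinear_compose[OF lc]
        continuous_bilinear_compose[OF rc]
        continuous_map_prod_fst_snd continuous_map_fst continuous_map_snd)
  moreover have "lbr ?E p p = 0" if "p \<in> carr ?E" for p
    using that by (auto simp: f0 L0 zero_prod_def)
  moreover have "lbr ?E p (lbr ?E p' p'') + lbr ?E p' (lbr ?E p'' p) + lbr ?E p'' (lbr ?E p p') = 0"
    if p: "p \<in> carr ?E" "p' \<in> carr ?E" "p'' \<in> carr ?E" for p p' p''
  proof -
    obtain a x where 1: "p = (a, x)" "a \<in> carr A" "x \<in> carr L" using p(1) by auto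
    obtain b y where 2: "p' = (b, y)" "b \<in> carr A" "y \<in> carr L" using p(2) by auto
    obtain c z where 3: "p'' = (c, z)" "c \<in> carr A" "z \<in> carr L" using p(3) by auto
    note d = 1(2,3) 2(2,3) 3(2,3)
    have "lbr L x (lbr L y z) + lbr L y (lbr L z x) + lbr L z (lbr L x y) = 0"
      using L d by (simp add: topological_lie_algebra_def)
    \<comment> \<open>The cyclic terms of the Jacobi sum are brought into the order used by the
      cocycle identity.\<close>
    moreover have "f [x, lbr L y z] = - f [lbr L y z, x]" "f [y, lbr L z x] = f [lbr L x z, y]"
      "f [z, lbr L x y] = - f [lbr L x y, z]" "f [z, x] = - f [x, z]"
      using d s[of "lbr L y z" x] s[of "lbr L z x" y] s[of "lbr L x y" z] s[of x z]
        lbr_antisym[OF L, of x z] by simp_all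
    moreover have "\<rho> x (f [y, z]) - \<rho> y (f [x, z]) + \<rho> z (f [x, y])
       - f [lbr L x y, z] + f [lbr L x z, y] - f [lbr L y z, x] = 0"
      using cocycle2D(2)[OF f tA] d by blast
    ultimately show ?thesis
      using d by (simp add: 1 2 3 m zero_prod_def algebra_simps)
  qed
  ultimately show ?thesis
    using tvs_twisted_sum[OF tA tL, of \<rho> f]
    by (simp add: topological_lie_algebra_def continuous_bilinear_def case_prod_unfold)
qed

lemma twisted_sum_extension:
  assumes K: "topspace K = UNIV" and L: "topological_lie_algebra K L"
    and M: "topological_module K L A \<rho>" and f: "f \<in> cocycles L A \<rho> 2"
  shows "split_abelian_extension K A \<rho> (twisted_sum A L \<rho> f) L (\<lambda>a. (a, 0)) snd"
proof -
  let ?E = "twisted_sum A L \<rho> f" and ?T = "prod_topology (vtop A) (vtop L)"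
  note tL = tla_tvs[OF L] and tA = tm_tvs[OF M]
  note tE = tvs_twisted_sum[OF tA tL, of \<rho> f]
  have b: "bilinear_map L L A (\<lambda>x y. f [x, y])"
    using cocycle2D(1)[OF f tA] by (simp add: cochains2_iff continuous_bilinear_def)
  note [simp] = tvs_simps[OF tL] tvs_simps[OF tA] bilinear_simps[OF tL tL tla_bilinear[OF L]]
    bilinear_simps[OF tL tA tm_bilinear[OF M]] bilinear_simps[OF tL tL b]
  have im: "(\<lambda>a. (a, 0)) ` carr A = carr A \<times> {0}" by auto
  have \<iota>c: "continuous_map (vtop A) ?T (\<lambda>a. (a, 0))"
    by (intro continuous_map_pairedI continuous_map_id[unfolded id_def]) simp
  have "homeomorphic_maps (vtop A) (subtopology ?T (carr A \<times> {0})) (\<lambda>a. (a, 0)) fst"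
    unfolding homeomorphic_maps_def using \<iota>c
    by (auto simp: continuous_map_in_subtopology continuous_map_fst continuous_map_from_subtopology)
  then have "embedding_map (vtop A) ?T (\<lambda>a. (a, 0))"
    unfolding embedding_map_def homeomorphic_map_maps im by blast
  \<comment> \<open>The projection \<open>(a, x) \<mapsto> (a, 0)\<close> splits off the copy of
    \<open>A\<close>.\<close>
  moreover have "topologically_split ?E (carr A \<times> {0})"
  proof (rule projection_topologically_split[OF K tE])
    show "module.subspace (vscale ?E) (carr A \<times> {0})"
      by (rule module.subspaceI[OF tvs_module[OF tE]]) (auto simp: zero_prod_def)
    have "continuous_map ?T ?T (\<lambda>p. (fst p, 0))"
      using continuous_map_compose[OF continuous_map_fst \<iota>c] by (simp add: o_def)
    then show "continuous_linear ?E (sub ?E (carr A \<times> {0})) (\<lambda>p. (fst p, 0))"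
      by (auto simp: linear_map_def continuous_map_in_subtopology)
  qed auto
  \<comment> \<open>Both carriers contain \<open>0\<close>, so neither space is empty; the second
    projection is then a quotient map.\<close>
  moreover have "vtop A \<noteq> trivial_topology" "vtop L \<noteq> trivial_topology"
    by (metis empty_iff null_topspace_iff_trivial tvs_simps(1)[OF tA])
      (metis empty_iff null_topspace_iff_trivial tvs_simps(1)[OF tL])
  moreover from this have "quotient_map ?T (vtop L) snd" by simp
  ultimately show ?thesis
    unfolding split_abelian_extension_def im lie_morphism_def
    using tla_twisted_sum[OF assms]
    by (auto simp: linear_map_def continuous_map_snd zero_prod_def)
qed

section \<open>The third cohomology\<close>

lemma continuous_bilinear_in:
  "continuous_bilinear U V W b \<Longrightarrow> u \<in> carr U \<Longrightarrow> v \<in> carr V \<Longrightarrow> b u v \<in> carr W"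
  by (auto simp: continuous_bilinear_def intro: linear_map_in dest: bilinear_mapD(1))

lemma cochain2_in:
  "\<omega> \<in> cochains L V 2 \<Longrightarrow> x \<in> carr L \<Longrightarrow> y \<in> carr L \<Longrightarrow> \<omega> [x, y] \<in> carr V"
  using continuous_bilinear_in[of L L V "\<lambda>x y. \<omega> [x, y]"] by (simp add: cochains2_iff)

lemma cochain3D:
  assumes "\<omega> \<in> cochains L V 3" "y \<in> carr L" "z \<in> carr L"
  shows "linear_map L V (\<lambda>x. \<omega> [x, y, z])" "linear_map L V (\<lambda>x. \<omega> [y, x, z])"
    "linear_map L V (\<lambda>x. \<omega> [y, z, x])"
proof -
  have l: "linear_map L V (\<lambda>x. \<omega> (xs[i := x]))" if "xs \<in> tuples L 3" "i < 3" for xs i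
    using assms(1) that unfolding cochains_def by blast
  \<comment> \<open>The entry that is going to be overwritten by \<open>x\<close> is a filler from
    the carrier.\<close>
  have t: "[y, y, z] \<in> tuples L 3" "[y, z, z] \<in> tuples L 3" using assms by (auto simp: tuples_iff)
  show "linear_map L V (\<lambda>x. \<omega> [x, y, z])" "linear_map L V (\<lambda>x. \<omega> [y, x, z])"
    "linear_map L V (\<lambda>x. \<omega> [y, z, x])"
    using l[OF t(1), of 0] l[OF t(1), of 1] l[OF t(2), of 2] by simp_all
qed

lemma coboundaries3_iff:
  "\<omega> \<in> coboundaries L V \<rho> 3 \<longleftrightarrow>
     \<omega> \<in> cochains L V 3 \<and> (\<exists>\<gamma>\<in>cochains L V 2. \<forall>xs\<in>tuples L 3. \<omega> xs = differential L V \<rho> \<gamma> xs)"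
proof -
  have "(case (3::nat) of 0 \<Rightarrow> a | Suc r \<Rightarrow> P r) = P 2" for a and P :: "nat \<Rightarrow> bool"
    by (simp add: numeral_3_eq_3 numeral_2_eq_2)
  then show ?thesis unfolding coboundaries_def by simp
qed

lemma coboundaries3_diff:
  assumes K: "topspace K = UNIV" and V: "topological_vector_space K V"
    and \<rho>: "\<And>x v w. x \<in> carr L \<Longrightarrow> v \<in> carr V \<Longrightarrow> w \<in> carr V \<Longrightarrow> \<rho> x (v - w) = \<rho> x v - \<rho> x w"
    and \<omega>: "\<omega> \<in> coboundaries L V \<rho> 3" "\<omega>' \<in> coboundaries L V \<rho> 3"
  shows "(\<lambda>xs. \<omega> xs - \<omega>' xs) \<in> coboundaries L V \<rho> 3"
proof -
  obtain \<gamma> \<gamma>' where g: "\<gamma> \<in> cochains L V 2" "\<gamma>' \<in> cochains L V 2"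
    and d: "\<And>xs. xs \<in> tuples L 3 \<Longrightarrow> \<omega> xs = differential L V \<rho> \<gamma> xs"
      "\<And>xs. xs \<in> tuples L 3 \<Longrightarrow> \<omega>' xs = differential L V \<rho> \<gamma>' xs"
    using \<omega> unfolding coboundaries3_iff by blast
  have "\<omega> xs - \<omega>' xs = differential L V \<rho> (\<lambda>xs. \<gamma> xs - \<gamma>' xs) xs" if xs: "xs \<in> tuples L 3" for xs
  proof -
    obtain x y z where x: "xs = [x, y, z]" "x \<in> carr L" "y \<in> carr L" "z \<in> carr L"
      using xs by (auto simp: tuples_iff)
    show ?thesis
      unfolding d[OF xs] unfolding x(1) differential2[OF V]
      using x(2-4) by (simp add: \<rho> cochain2_in[OF g(1)] cochain2_in[OF g(2)])
  qed
  then show ?thesis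
    using \<omega> cochains_diff[OF K V] g unfolding coboundaries3_iff by blast
qed

text \<open>Coboundaries are closed under differences, so being cohomologous is an equivalence
  relation. The action enters through its compatibility with differences, the form in which it is
  available for \<open>quot_act\<close>.\<close>

lemma cohomology_class3_eq_iff:
  assumes K: "topspace K = UNIV" and V: "topological_vector_space K V"
    and \<rho>: "\<And>x v w. x \<in> carr L \<Longrightarrow> v \<in> carr V \<Longrightarrow> w \<in> carr V \<Longrightarrow> \<rho> x (v - w) = \<rho> x v - \<rho> x w"
    and c: "\<beta> \<in> cocycles L V \<rho> 3" "\<beta>' \<in> cocycles L V \<rho> 3"
  shows "cohomology_class L V \<rho> 3 \<beta> = cohomology_class L V \<rho> 3 \<beta>' \<longleftrightarrow>
     (\<lambda>xs. \<beta> xs - \<beta>' xs) \<in> coboundaries L V \<rho> 3"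
    (is "?l \<longleftrightarrow> ?r")
proof -
  let ?B = "coboundaries L V \<rho> 3"
  have diff: "(\<lambda>xs. \<omega> xs - \<omega>' xs) \<in> ?B" if "\<omega> \<in> ?B" "\<omega>' \<in> ?B" for \<omega> \<omega>'
    by (rule coboundaries3_diff[OF K V _ that]) (rule \<rho>)
  have class_iff: "\<omega> \<in> cohomology_class L V \<rho> 3 \<beta> \<longleftrightarrow>
      \<omega> \<in> cocycles L V \<rho> 3 \<and> (\<lambda>xs. \<beta> xs - \<omega> xs) \<in> ?B"
    if "\<beta> \<in> cocycles L V \<rho> 3" for \<beta> \<omega>
    using that by (auto simp: cohomology_class_def cohomology_rel_def)
  have r0: "\<rho> x 0 = 0" if "x \<in> carr L" for x
    using \<rho>[OF that tvs_simps(1)[OF V] tvs_simps(1)[OF V]] by simp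
  have "differential L V \<rho> (\<lambda>_. 0) xs = 0" if "xs \<in> tuples L 3" for xs
    using that r0 by (auto simp: tuples_iff differential2[OF V])
  then have zero: "(\<lambda>_. 0) \<in> ?B"
    unfolding coboundaries3_iff using cochains_zero[OF V] by force
  show ?thesis
  proof
    assume ?l
    then have "\<beta>' \<in> cohomology_class L V \<rho> 3 \<beta>"
      using class_iff[OF c(2)] c(2) zero by simp
    then show ?r using class_iff[OF c(1)] by simp
  next
    assume r: ?r
    from diff[OF zero r] have r': "(\<lambda>xs. \<beta>' xs - \<beta> xs) \<in> ?B" by simp
    have "(\<lambda>xs. \<beta> xs - \<omega> xs) \<in> ?B \<longleftrightarrow> (\<lambda>xs. \<beta>' xs - \<omega> xs) \<in> ?B" for \<omega>
      using diff[OF _ r, of "\<lambda>xs. \<beta> xs - \<omega> xs"] diff[OF _ r', of "\<lambda>xs. \<beta>' xs - \<omega> xs"] by auto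
    then show ?l
      using class_iff[OF c(1)] class_iff[OF c(2)] by blast
  qed
qed


section \<open>Split crossed modules\<close>

lemma bilinear_map_sub:
  assumes b: "bilinear_map U V W b" and S: "S \<subseteq> carr U" "S' \<subseteq> carr V"
    and T: "\<And>u v. u \<in> S \<Longrightarrow> v \<in> S' \<Longrightarrow> b u v \<in> T" 
  shows "bilinear_map (sub U S) (sub V S') (sub W T) b"
  using assms by (auto simp: bilinear_map_def linear_map_def subset_iff image_subset_iff)

lemma continuous_bilinear_sub:
  assumes b: "continuous_bilinear U V W b" and S: "S \<subseteq> carr U" "S' \<subseteq> carr V"
    and T: "\<And>u v. u \<in> S \<Longrightarrow> v \<in> S' \<Longrightarrow> b u v \<in> T" 
  shows "continuous_bilinear (sub U S) (sub V S') (sub W T) b"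
proof -
  have "continuous_map (prod_topology (subtopology (vtop U) S) (subtopology (vtop V) S')) (vtop W) (\<lambda>(u, v). b u v)"
    using b unfolding continuous_bilinear_def
    by (metis continuous_map_from_subtopology subtopology_Times)
  then show ?thesis
    using bilinear_map_sub[OF _ S T] b T
    by (auto simp: continuous_bilinear_def continuous_map_in_subtopology)
qed

text \<open>Lets restriction to a pair of subspaces specialise to a proper restriction in only one
  of the two slots.\<close>

lemma sub_carr: "sub V (carr V) = V"
  by (simp add: sub_def)

lemma tla_sub:
  assumes L: "topological_lie_algebra K L" and S: "module.subspace (vscale L) S" "S \<subseteq> carr L"
    and b: "\<And>x y. x \<in> S \<Longrightarrow> y \<in> S \<Longrightarrow> lbr L x y \<in> S"
  shows "topological_lie_algebra K (sub L S)"
  using L tvs_sub[OF tla_tvs[OF L] S] continuous_bilinear_sub[of L L L "lbr L" S S S] S b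
  by (auto simp: topological_lie_algebra_def)

lemma tm_sub:
  assumes L: "topological_lie_algebra K L" and M: "topological_module K L V \<rho>"
    and S: "S \<subseteq> carr L"
    and T: "module.subspace (vscale V) T" "T \<subseteq> carr V" "\<And>x v. x \<in> S \<Longrightarrow> v \<in> T \<Longrightarrow> \<rho> x v \<in> T"
  shows "topological_module K (sub L S) (sub V T) \<rho>"
  using M tvs_sub[OF tm_tvs[OF M] T(1,2)] continuous_bilinear_sub[of L V V \<rho> S T T] S T
  by (auto simp: topological_module_def subset_iff)

lemma quot_lie_simps [simp]:
  "vtop (quot_lie L N) = vtop (quot_tvs L N)" "vscale (quot_lie L N) = vscale (quot_tvs L N)"
  "lbr (quot_lie L N) X Y = (\<Union>x\<in>X. \<Union>y\<in>Y. lbr L x y +o N)"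
  by (simp_all add: quot_lie_def tvs.defs)

section \<open>Ideal, kernel and module structures of a split crossed module\<close>

locale split_xmod =
  fixes K :: "'k::field topology"
    and H :: "('k, 'h::ab_group_add) tla"
    and G :: "('k, 'g::ab_group_add) tla"
    and act :: "'g \<Rightarrow> 'h \<Rightarrow> 'h"
    and \<alpha> :: "'h \<Rightarrow> 'g"
  assumes K: "topspace K = UNIV"
    and split_crossed: "split_crossed_module K H G act \<alpha>"
begin

abbreviation "n \<equiv> \<alpha> ` carr H"
abbreviation "Z \<equiv> ker_mod H \<alpha>"
abbreviation "N \<equiv> im_lie H G \<alpha>"
abbreviation "Q \<equiv> quot_lie G n"
abbreviation "q x \<equiv> x +o n"

lemma HL: "topological_lie_algebra K H" and GL: "topological_lie_algebra K G"
  and actM: "topological_module K G H act"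
  and \<alpha>: "continuous_linear H G \<alpha>"
  and \<alpha>_lbr: "x \<in> carr H \<Longrightarrow> y \<in> carr H \<Longrightarrow> \<alpha> (lbr H x y) = lbr G (\<alpha> x) (\<alpha> y)"
  and \<alpha>_act: "g \<in> carr G \<Longrightarrow> x \<in> carr H \<Longrightarrow> \<alpha> (act g x) = lbr G g (\<alpha> x)"
  and act_\<alpha>: "x \<in> carr H \<Longrightarrow> y \<in> carr H \<Longrightarrow> act (\<alpha> x) y = lbr H x y"
  and split_n: "topologically_split G n"
  and ext: "split_abelian_extension K Z act H N (\<lambda>h. h) \<alpha>"
  using split_crossed by (auto simp: split_crossed_module_def crossed_module_def lie_morphism_def)

lemma subspace_n: "module.subspace (vscale G) n" "n \<subseteq> carr G"
  using split_n by (auto simp: topologically_split_def)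

lemma subspace_ker: "module.subspace (vscale H) {h \<in> carr H. \<alpha> h = 0}"
  using split_crossed by (auto simp: split_crossed_module_def topologically_split_def)

lemmas tH = tla_tvs[OF HL] and tG = tla_tvs[OF GL]

lemma carr_Z: "carr Z = {h \<in> carr H. \<alpha> h = 0}" and vscale_Z [simp]: "vscale Z = vscale H"
  and vtop_Z: "vtop Z = subtopology (vtop H) {h \<in> carr H. \<alpha> h = 0}"
  by (auto simp: ker_mod_def)

lemma carr_N: "carr N = n" and vscale_N [simp]: "vscale N = vscale G" and lbr_N [simp]: "lbr N = lbr G"
  and vtop_N: "vtop N = subtopology (vtop G) n"
  using subspace_n by (auto simp: im_lie_def)

text \<open>The image is an ideal because \<open>lbr G x (\<alpha> h)\<close> equals
  \<open>\<alpha> (act x h)\<close>.\<close>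

lemma lbr_n: "x \<in> carr G \<Longrightarrow> m \<in> n \<Longrightarrow> lbr G x m \<in> n"
  using bilinear_simps(1)[OF tG tH tm_bilinear[OF actM]] by (auto simp flip: \<alpha>_act)

lemma lbr_n': "m \<in> n \<Longrightarrow> x \<in> carr G \<Longrightarrow> lbr G m x \<in> n"
  using lbr_antisym[OF GL, of x m] lbr_n[of x m] subspace_n(2)
    module.subspace_neg[OF tvs_module[OF tG] subspace_n(1)] by auto

lemma NL: "topological_lie_algebra K N"
  unfolding im_lie_def using subspace_n lbr_n by (intro tla_sub[OF GL]) auto

text \<open>The same equation, read for \<open>\<alpha> h = 0\<close>, shows that \<open>G\<close>
  preserves the kernel.\<close>

lemma ZM: "topological_module K G Z act"
proof -
  have "topological_module K (sub G (carr G)) Z act"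
    unfolding ker_mod_def
  proof (rule tm_sub[OF GL actM _ subspace_ker])
    show "act x v \<in> {h \<in> carr H. \<alpha> h = 0}" if "x \<in> carr G" "v \<in> {h \<in> carr H. \<alpha> h = 0}" for x v
      using that bilinear_simps[OF tG tH tm_bilinear[OF actM]]
        bilinear_simps(5)[OF tG tG tla_bilinear[OF GL]] by (simp add: \<alpha>_act)
  qed auto
  then show ?thesis by (simp only: sub_carr)
qed

lemmas tZ = tm_tvs[OF ZM] and tN = tla_tvs[OF NL]

lemma NM: "topological_module K N Z act"
proof -
  have "topological_module K (sub G n) (sub Z (carr Z)) act"
  proof (rule tm_sub[OF GL ZM subspace_n(2)])
    show "module.subspace (vscale Z) (carr Z)" using subspace_ker by (simp add: carr_Z)
    show "act x v \<in> carr Z" if "x \<in> n" "v \<in> carr Z" for x v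
      using bilinear_simps(1)[OF tG tZ tm_bilinear[OF ZM]] that subspace_n by blast
  qed auto
  then show ?thesis by (simp add: sub_carr im_lie_def)
qed

text \<open>If \<open>m = \<alpha> h\<close>, then \<open>m\<close> acts on \<open>z\<close> as the
  bracket with \<open>h\<close>, that is, as \<open>- lbr H z h\<close>; and
  \<open>lbr H z h\<close> is the action of \<open>\<alpha> z = 0\<close> on
  \<open>h\<close>.\<close>

lemma act_n_Z: "m \<in> n \<Longrightarrow> z \<in> carr Z \<Longrightarrow> act m z = 0"
proof -
  assume m: "m \<in> n" and z: "z \<in> carr Z"
  then obtain h where h: "h \<in> carr H" "m = \<alpha> h" by auto
  have "act m z = - lbr H z h" using h z act_\<alpha>[of h z] lbr_antisym[OF HL, of z h] by (simp add: carr_Z)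
  also have "lbr H z h = act 0 h" using h z act_\<alpha>[of z h] by (simp add: carr_Z)
  also have "\<dots> = 0" using bilinear_simps(9)[OF tG tH tm_bilinear[OF actM]] h by simp
  finally show ?thesis by simp
qed

lemma in_ZI: "h \<in> carr H \<Longrightarrow> \<alpha> h = 0 \<Longrightarrow> h \<in> carr Z"
  by (simp add: carr_Z)

lemma Z_in: "z \<in> carr Z \<Longrightarrow> z \<in> carr H" and \<alpha>_Z: "z \<in> carr Z \<Longrightarrow> \<alpha> z = 0"
  and n_in: "m \<in> n \<Longrightarrow> m \<in> carr G"
  using subspace_n by (auto simp: carr_Z)

lemma n_closed: "0 \<in> n" "x \<in> n \<Longrightarrow> y \<in> n \<Longrightarrow> x + y \<in> n" "x \<in> n \<Longrightarrow> y \<in> n \<Longrightarrow> x - y \<in> n"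
  "x \<in> n \<Longrightarrow> - x \<in> n" "x \<in> n \<Longrightarrow> vscale G c x \<in> n"
  using tvs_simps[OF tN] by (simp_all add: carr_N)

lemma act_cocycle:
  "x \<in> carr G \<Longrightarrow> y \<in> carr G \<Longrightarrow> h \<in> carr H \<Longrightarrow> act (lbr G x y) h = act x (act y h) - act y (act x h)"
  using actM by (simp add: topological_module_def)

lemmas base_simps =
  tvs_simps[OF tH] tvs_simps[OF tG] tvs_simps[OF tZ, unfolded vscale_Z]
  bilinear_simps[OF tG tH tm_bilinear[OF actM]] bilinear_simps[OF tG tG tla_bilinear[OF GL]]
  bilinear_simps(1)[OF tG tZ tm_bilinear[OF ZM]]
  bilinear_simps[OF tH tH tla_bilinear[OF HL]] linear_map_simps[OF tH conjunct1[OF \<alpha>]]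
  Z_in \<alpha>_Z n_in n_closed lbr_n lbr_n' act_n_Z \<alpha>_act \<alpha>_lbr carr_N

section \<open>Presentations as linear sections of \<open>\<alpha>\<close>\<close>

text \<open>\<open>s\<close> is a linear section of \<open>\<alpha>\<close> and \<open>\<theta>\<close> measures its failure to be \<open>G\<close>-equivariant; these
  are the data of a presentation, the cocycle \<open>f\<close> being the restriction of \<open>\<theta>\<close>.\<close>

definition sect :: "('g \<Rightarrow> 'h) \<Rightarrow> ('g \<Rightarrow> 'g \<Rightarrow> 'h) \<Rightarrow> bool" where
  "sect s \<theta> \<longleftrightarrow>
     continuous_linear N H s \<and> (\<forall>m\<in>n. \<alpha> (s m) = m) \<and> continuous_bilinear G N Z \<theta> \<and>
     (\<forall>x\<in>carr G. \<forall>m\<in>n. act x (s m) = \<theta> x m + s (lbr G x m))"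

text \<open>Splitting \<open>\<alpha>\<close> as an abelian extension of its image gives a section
  \<open>s\<close> and its cocycle \<open>f\<close>; \<open>\<Phi>\<close> is then
  \<open>(z, m) \<mapsto> z + s m\<close>.\<close>

lemma presentation_exists: "\<exists>f \<theta> \<Phi>. presentation H G act \<alpha> f \<theta> \<Phi>"
proof -
  obtain s where s: "continuous_linear N H s" "\<And>m. m \<in> carr N \<Longrightarrow> \<alpha> (s m) = m"
    using split_extension_section[OF K ext] by blast
  obtain f where f: "f \<in> cocycles N Z act 2"
    "\<And>x y. x \<in> carr N \<Longrightarrow> y \<in> carr N \<Longrightarrow> f [x, y] = lbr H (s x) (s y) - s (lbr G x y)"
    using section_cocycle[OF K ext NL NM s] by auto
  note [simp] = base_simps s(2)[unfolded carr_N]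
    linear_map_simps[OF tN conjunct1[OF s(1)], unfolded carr_N vscale_N]
  \<comment> \<open>The failure of \<open>s\<close> to be \<open>G\<close>-equivariant;
    \<open>\<alpha>\<close> kills it because both terms map to \<open>lbr G x m\<close>.\<close>
  define \<theta> where "\<theta> x m = act x (s m) - s (lbr G x m)" for x m
  define \<Phi> where "\<Phi> p = fst p + s (snd p)" for p
  have \<theta>_in: "\<theta> x m \<in> carr Z" if "x \<in> carr G" "m \<in> n" for x m
    by (rule in_ZI) (use that in \<open>simp_all add: \<theta>_def\<close>)
  have \<theta>c: "continuous_bilinear G N Z \<theta>"
    unfolding continuous_bilinear_def
  proof
    show "bilinear_map G N Z \<theta>"
      unfolding bilinear_map_def
      by (auto intro!: linear_mapI \<theta>_in[unfolded image_iff] simp: \<theta>_in, auto simp: \<theta>_def algebra_simps)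
    let ?P = "prod_topology (vtop G) (vtop N)"
    have m: "continuous_map ?P (vtop G) snd"
      using continuous_map_snd[of "vtop G" "vtop N"] unfolding vtop_N
      by (blast dest: continuous_map_into_fulltopology)
    have lc: "continuous_bilinear G G G (lbr G)" and rc: "continuous_bilinear G H H act"
      using GL actM by (simp_all add: topological_lie_algebra_def topological_module_def)
    have "continuous_map ?P (vtop G) (\<lambda>p. lbr G (fst p) (snd p))"
      by (rule continuous_bilinear_compose[OF lc continuous_map_fst m])
    then have 1: "continuous_map ?P (vtop N) (\<lambda>p. lbr G (fst p) (snd p))"
      unfolding vtop_N by (auto simp: continuous_map_in_subtopology)
    have "continuous_map ?P (vtop H) (\<lambda>p. \<theta> (fst p) (snd p))"
      unfolding \<theta>_def
      using continuous_map_compose[OF 1 conjunct2[OF s(1)]]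
      by (intro continuous_map_tvs_diff[OF K tH] continuous_bilinear_compose[OF rc]
          continuous_map_fst continuous_map_prod_fst_snd s(1)[THEN conjunct2]) (simp add: o_def)
    then show "continuous_map ?P (vtop Z) (\<lambda>(x, m). \<theta> x m)"
      using \<theta>_in unfolding vtop_Z carr_Z by (auto simp: continuous_map_in_subtopology case_prod_unfold)
  qed
  have iso: "lie_iso (twisted_sum Z N act f) H \<Phi>"
    unfolding lie_iso_def lie_morphism_def
  proof (intro conjI ballI)
    let ?T = "prod_topology (vtop Z) (vtop N)"
    show "linear_map (twisted_sum Z N act f) H \<Phi>"
      by (rule linear_mapI) (auto simp: \<Phi>_def)
    show "\<Phi> (lbr (twisted_sum Z N act f) x y) = lbr H (\<Phi> x) (\<Phi> y)"
      if xy: "x \<in> carr (twisted_sum Z N act f)" "y \<in> carr (twisted_sum Z N act f)" for x y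
    proof -
      obtain z m z' m' where d: "x = (z, m)" "y = (z', m')" "z \<in> carr Z" "z' \<in> carr Z" "m \<in> n" "m' \<in> n"
        using xy by (auto simp: carr_N)
      \<comment> \<open>The kernel is central in \<open>H\<close>, so only the bracket of the two
        section values remains.\<close>
      have "lbr H z (s m') = 0" "lbr H z z' = 0" "lbr H (s m) z' = 0"
        using d act_\<alpha>[of z "s m'"] act_\<alpha>[of z z'] act_\<alpha>[of "s m" z'] by simp_all
      then show ?thesis using d f(2)[unfolded carr_N, OF d(5,6)] by (simp add: \<Phi>_def)
    qed
    have 1: "continuous_map ?T (vtop H) fst"
      using continuous_map_fst[of "vtop Z" "vtop N"] unfolding vtop_Z
      by (blast dest: continuous_map_into_fulltopology)
    have c: "continuous_map ?T (vtop H) \<Phi>"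
      unfolding \<Phi>_def
      by (intro continuous_map_tvs_add[OF tH] 1 continuous_map_prod_fst_snd s(1)[THEN conjunct2])
    then show "continuous_map (vtop (twisted_sum Z N act f)) (vtop H) \<Phi>" by simp
    have \<alpha>N: "continuous_map (vtop H) (vtop N) \<alpha>"
      unfolding vtop_N using \<alpha> by (auto simp: continuous_map_in_subtopology)
    have "continuous_map (vtop H) (vtop H) (\<lambda>h. h - s (\<alpha> h))"
      using continuous_map_compose[OF \<alpha>N conjunct2[OF s(1)]]
      by (intro continuous_map_tvs_diff[OF K tH] continuous_map_id[unfolded id_def]) (simp add: o_def)
    then have "continuous_map (vtop H) (vtop Z) (\<lambda>h. h - s (\<alpha> h))"
      unfolding vtop_Z by (auto simp: continuous_map_in_subtopology)
    \<comment> \<open>The inverse splits \<open>h\<close> into its kernel component and its image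
      under \<open>\<alpha>\<close>.\<close>
    then have "homeomorphic_maps ?T (vtop H) \<Phi> (\<lambda>h. (h - s (\<alpha> h), \<alpha> h))"
      unfolding homeomorphic_maps_def using c \<alpha>N
      by (auto intro: continuous_map_pairedI simp: \<Phi>_def)
    then show "homeomorphic_map (vtop (twisted_sum Z N act f)) (vtop H) \<Phi>"
      using homeomorphic_map_maps by (simp, blast)
  qed
  have "presentation H G act \<alpha> f \<theta> \<Phi>"
    unfolding presentation_def Let_def
    using f(1) iso \<theta>c by (auto simp: \<Phi>_def \<theta>_def)
  then show ?thesis by blast
qed

text \<open>By additivity \<open>\<Phi> (\<theta> x m, lbr G x m)\<close> splits into two summands,
  and the first is \<open>\<theta> x m\<close> since \<open>\<Phi> (z, 0) = z\<close> on the
  kernel.\<close>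

lemma presentation_sect:
  assumes "presentation H G act \<alpha> f \<theta> \<Phi>"
  shows "sect (\<lambda>m. \<Phi> (0, m)) \<theta>"
proof -
  have \<Phi>: "continuous_linear (twisted_sum Z N act f) H \<Phi>" and \<Phi>z: "\<And>z. z \<in> carr Z \<Longrightarrow> \<Phi> (z, 0) = z"
    and \<alpha>\<Phi>: "\<And>z m. z \<in> carr Z \<Longrightarrow> m \<in> n \<Longrightarrow> \<alpha> (\<Phi> (z, m)) = m"
    and \<theta>: "continuous_bilinear G N Z \<theta>"
    and a: "\<And>x z m. x \<in> carr G \<Longrightarrow> z \<in> carr Z \<Longrightarrow> m \<in> n \<Longrightarrow>
      act x (\<Phi> (z, m)) = \<Phi> (act x z + \<theta> x m, lbr G x m)"
    using assms by (auto simp: presentation_def Let_def lie_iso_def lie_morphism_def carr_N)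
  have \<theta>_in: "\<theta> x m \<in> carr Z" if "x \<in> carr G" "m \<in> n" for x m
    using continuous_bilinear_in[OF \<theta>] that by (simp add: carr_N)
  have lin: "linear_map N (twisted_sum Z N act f) (\<lambda>m. (0, m))"
    by (rule linear_mapI) (auto simp: base_simps)
  have cont: "continuous_map (vtop N) (prod_topology (vtop Z) (vtop N)) (\<lambda>m. (0, m))"
    by (intro continuous_map_pairedI continuous_map_id[unfolded id_def]) (simp add: base_simps)
  have "continuous_linear N H (\<lambda>m. \<Phi> (0, m))"
    using linear_map_comp[OF lin conjunct1[OF \<Phi>]] continuous_map_compose[OF cont, of "vtop H" \<Phi>] \<Phi>
    by (simp add: o_def)
  moreover have "act x (\<Phi> (0, m)) = \<theta> x m + \<Phi> (0, lbr G x m)" if "x \<in> carr G" "m \<in> n" for x m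
  proof -
    have "act x (\<Phi> (0, m)) = \<Phi> ((\<theta> x m, 0) + (0, lbr G x m))"
      using a[of x 0 m] that by (simp add: base_simps)
    also have "\<dots> = \<Phi> (\<theta> x m, 0) + \<Phi> (0, lbr G x m)"
      using linear_map_simps(2)[OF tvs_twisted_sum[OF tZ tN] conjunct1[OF \<Phi>],
          of "(\<theta> x m, 0)" "(0, lbr G x m)"] that
      by (simp add: \<theta>_in base_simps)
    finally show ?thesis using \<Phi>z \<theta>_in that by simp
  qed
  ultimately show ?thesis
    using \<theta> \<alpha>\<Phi> by (simp add: sect_def base_simps)
qed

lemma sect_simps:
  assumes s: "sect s \<theta>"
  shows "m \<in> n \<Longrightarrow> s m \<in> carr H" "m \<in> n \<Longrightarrow> m' \<in> n \<Longrightarrow> s (m + m') = s m + s m'"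
    "m \<in> n \<Longrightarrow> m' \<in> n \<Longrightarrow> s (m - m') = s m - s m'" "m \<in> n \<Longrightarrow> s (- m) = - s m" "s 0 = 0"
    "m \<in> n \<Longrightarrow> s (vscale G c m) = vscale H c (s m)"
    "m \<in> n \<Longrightarrow> \<alpha> (s m) = m"
    "x \<in> carr G \<Longrightarrow> m \<in> n \<Longrightarrow> act x (s m) = \<theta> x m + s (lbr G x m)"
    "x \<in> carr G \<Longrightarrow> m \<in> n \<Longrightarrow> \<theta> x m \<in> carr Z"
    "x \<in> carr G \<Longrightarrow> m \<in> n \<Longrightarrow> m' \<in> n \<Longrightarrow> \<theta> x (m + m') = \<theta> x m + \<theta> x m'"
    "x \<in> carr G \<Longrightarrow> m \<in> n \<Longrightarrow> m' \<in> n \<Longrightarrow> \<theta> x (m - m') = \<theta> x m - \<theta> x m'"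
    "x \<in> carr G \<Longrightarrow> m \<in> n \<Longrightarrow> \<theta> x (- m) = - \<theta> x m"
    "x \<in> carr G \<Longrightarrow> \<theta> x 0 = 0"
    "x \<in> carr G \<Longrightarrow> m \<in> n \<Longrightarrow> \<theta> x (vscale G c m) = vscale H c (\<theta> x m)"
    "x \<in> carr G \<Longrightarrow> y \<in> carr G \<Longrightarrow> m \<in> n \<Longrightarrow> \<theta> (x + y) m = \<theta> x m + \<theta> y m"
    "x \<in> carr G \<Longrightarrow> y \<in> carr G \<Longrightarrow> m \<in> n \<Longrightarrow> \<theta> (x - y) m = \<theta> x m - \<theta> y m"
    "x \<in> carr G \<Longrightarrow> m \<in> n \<Longrightarrow> \<theta> (vscale G c x) m = vscale H c (\<theta> x m)"
proof -
  have l: "linear_map N H s" and b: "bilinear_map G N Z \<theta>"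
    using s by (simp_all add: sect_def continuous_bilinear_def)
  note ls = linear_map_simps[OF tN l, unfolded carr_N vscale_N]
  note bs = bilinear_simps[OF tG tN b, unfolded carr_N vscale_N vscale_Z]
  show "m \<in> n \<Longrightarrow> \<alpha> (s m) = m" 
    "x \<in> carr G \<Longrightarrow> m \<in> n \<Longrightarrow> act x (s m) = \<theta> x m + s (lbr G x m)"
    using s unfolding sect_def by blast+
  show "m \<in> n \<Longrightarrow> s m \<in> carr H" "m \<in> n \<Longrightarrow> m' \<in> n \<Longrightarrow> s (m + m') = s m + s m'"
    "m \<in> n \<Longrightarrow> m' \<in> n \<Longrightarrow> s (m - m') = s m - s m'" "m \<in> n \<Longrightarrow> s (- m) = - s m" "s 0 = 0"
    "m \<in> n \<Longrightarrow> s (vscale G c m) = vscale H c (s m)"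
    by (simp_all only: ls)
  show "x \<in> carr G \<Longrightarrow> m \<in> n \<Longrightarrow> \<theta> x m \<in> carr Z"
    "x \<in> carr G \<Longrightarrow> m \<in> n \<Longrightarrow> m' \<in> n \<Longrightarrow> \<theta> x (m + m') = \<theta> x m + \<theta> x m'"
    "x \<in> carr G \<Longrightarrow> m \<in> n \<Longrightarrow> m' \<in> n \<Longrightarrow> \<theta> x (m - m') = \<theta> x m - \<theta> x m'"
    "x \<in> carr G \<Longrightarrow> m \<in> n \<Longrightarrow> \<theta> x (- m) = - \<theta> x m"
    "x \<in> carr G \<Longrightarrow> \<theta> x 0 = 0"
    "x \<in> carr G \<Longrightarrow> m \<in> n \<Longrightarrow> \<theta> x (vscale G c m) = vscale H c (\<theta> x m)"
    "x \<in> carr G \<Longrightarrow> y \<in> carr G \<Longrightarrow> m \<in> n \<Longrightarrow> \<theta> (x + y) m = \<theta> x m + \<theta> y m"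
    "x \<in> carr G \<Longrightarrow> y \<in> carr G \<Longrightarrow> m \<in> n \<Longrightarrow> \<theta> (x - y) m = \<theta> x m - \<theta> y m"
    "x \<in> carr G \<Longrightarrow> m \<in> n \<Longrightarrow> \<theta> (vscale G c x) m = vscale H c (\<theta> x m)"
    by (simp_all only: bs)
qed

section \<open>Identities for \<theta> and its extension to a two-cochain\<close>

lemma theta_diag:
  assumes s: "sect s \<theta>" and m: "m \<in> n"
  shows "\<theta> m m = 0"
proof -
  note [simp] = base_simps sect_simps[OF s]
  have L0: "lbr G x x = 0" if "x \<in> carr G" for x using GL that by (simp add: topological_lie_algebra_def)
  \<comment> \<open>Since \<open>m = \<alpha> (s m)\<close>, the action of \<open>m\<close> on
    \<open>s m\<close> is a bracket of \<open>s m\<close> with itself, hence zero.\<close>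
  have "act (\<alpha> (s m)) (s m) = lbr H (s m) (s m)"
    using m act_\<alpha>[of "s m" "s m"] by (simp del: sect_simps(7))
  then show ?thesis
    using HL m by (simp add: L0 topological_lie_algebra_def)
qed

text \<open>This is the two-cocycle identity with its last argument in the image of
  \<open>\<alpha>\<close>. It results from evaluating the representation property on
  \<open>s m\<close>; the terms in \<open>s\<close> cancel by Jacobi.\<close>

lemma theta_cocycle:
  assumes s: "sect s \<theta>" and x: "x \<in> carr G" "y \<in> carr G" and m: "m \<in> n"
  shows "act x (\<theta> y m) - act y (\<theta> x m) - \<theta> (lbr G x y) m - \<theta> y (lbr G x m) + \<theta> x (lbr G y m) = 0"
proof -
  note [simp] = base_simps sect_simps[OF s]
  have j: "lbr G (lbr G x y) m = lbr G x (lbr G y m) - lbr G y (lbr G x m)"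
    using lbr_jacobi[OF GL x, of m] lbr_antisym[OF GL, of x "lbr G y m"]
      lbr_antisym[OF GL, of y "lbr G x m"] x m by simp
  have "act (lbr G x y) (s m) = act x (act y (s m)) - act y (act x (s m))"
    using x m by (intro act_cocycle) simp_all
  then show ?thesis
    using x m by (simp add: j algebra_simps)
qed

lemma theta_extends:
  assumes s: "sect s \<theta>"
  shows "\<exists>F\<in>cochains G Z 2. extends_theta H G \<alpha> \<theta> F"
proof -
  obtain p where p: "continuous_linear G (sub G n) p" "\<And>m. m \<in> n \<Longrightarrow> p m = m"
    by (rule topologically_split_projection[OF K tG split_n], rule that)
  have pN: "continuous_linear G N p" using p(1) by (simp add: im_lie_def)
  note [simp] = base_simps sect_simps[OF s] linear_map_simps[OF tG conjunct1[OF pN], unfolded carr_N vscale_N]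
  \<comment> \<open>Polarization again, written out because the two slots of \<open>\<theta>\<close>
    range over different carriers.\<close>
  have anti: "\<theta> y x = - \<theta> x y" if "x \<in> n" "y \<in> n" for x y
  proof -
    have "\<theta> (x + y) (x + y) = 0" using that by (intro theta_diag[OF s]) simp
    then show ?thesis
      using that theta_diag[OF s that(1)] theta_diag[OF s that(2)]
      by (simp add: eq_neg_iff_add_eq_0 add.commute)
  qed
  \<comment> \<open>At \<open>[x, m]\<close> with \<open>p m = m\<close> the last two terms cancel
    by antisymmetry, leaving \<open>\<theta> x m\<close>. On the diagonal the first two cancel and
    the third is zero by \<open>theta_diag\<close>.\<close>
  define F where "F xs = \<theta> (xs ! 0) (p (xs ! 1)) - \<theta> (xs ! 1) (p (xs ! 0)) - \<theta> (p (xs ! 0)) (p (xs ! 1))" for xs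
  have \<theta>: "continuous_bilinear G N Z \<theta>" using s by (simp add: sect_def)
  have "bilinear_map G G Z (\<lambda>x y. F [x, y])"
    unfolding bilinear_map_def
    by (auto intro!: linear_mapI simp: F_def algebra_simps)
  moreover have "continuous_map (prod_topology (vtop G) (vtop G)) (vtop Z) (\<lambda>a. F [fst a, snd a])"
  proof -
    let ?P = "prod_topology (vtop G) (vtop G)"
    have pp: "continuous_map ?P (vtop N) (\<lambda>a. p (fst a))" "continuous_map ?P (vtop N) (\<lambda>a. p (snd a))"
      using continuous_map_prod_fst_snd[OF conjunct2[OF pN]] by auto
    then have "continuous_map ?P (vtop G) (\<lambda>a. p (fst a))"
      unfolding vtop_N using continuous_map_into_fulltopology by blast
    then show ?thesis
      unfolding F_def
      using continuous_map_tvs_diff[OF K tZ continuous_map_tvs_diff[OF K tZ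
            continuous_bilinear_compose[OF \<theta> continuous_map_fst pp(2)]
            continuous_bilinear_compose[OF \<theta> continuous_map_snd pp(1)]]
          continuous_bilinear_compose[OF \<theta> _ pp(2)]] by simp
  qed
  moreover have "F [x, x] = 0" if "x \<in> carr G" for x
    using that theta_diag[OF s, of "p x"] by (simp add: F_def)
  ultimately have "F \<in> cochains G Z 2"
    by (simp add: cochains2_iff continuous_bilinear_def case_prod_unfold)
  moreover have "F [x, m] = \<theta> x m" if "x \<in> carr G" "m \<in> n" for x m
    using that anti[of "p x" m] by (simp add: F_def p(2))
  then have "extends_theta H G \<alpha> \<theta> F"
    unfolding extends_theta_def carr_N by blast
  ultimately show ?thesis by blast
qed

text \<open>The value \<open>F [x, y]\<close> occurs only under the action of \<open>m\<close>,
  which is zero on the kernel; up to sign the other five terms are those of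
  \<open>theta_cocycle\<close>.\<close>

lemma differential_vanishes:
  assumes s: "sect s \<theta>" and F: "F \<in> cochains G Z 2" and F\<theta>: "extends_theta H G \<alpha> \<theta> F"
    and x: "x \<in> carr G" "y \<in> carr G" and m: "m \<in> n"
  shows "differential G Z act F [x, y, m] = 0" "differential G Z act F [x, m, y] = 0"
    "differential G Z act F [m, x, y] = 0"
proof -
  note [simp] = base_simps sect_simps[OF s]
  have b: "bilinear_map G G Z (\<lambda>x y. F [x, y])" and F0: "\<And>x. x \<in> carr G \<Longrightarrow> F [x, x] = 0"
    using F by (auto simp: cochains2_iff continuous_bilinear_def)
  have anti: "F [y, x] = - F [x, y]" if "x \<in> carr G" "y \<in> carr G" for x y
    using that by (intro alternating_antisym[OF tG b]) (auto intro: F0)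
  have 1: "F [x, m] = \<theta> x m" "F [m, x] = - \<theta> x m" if "x \<in> carr G" "m \<in> n" for x m
    using that F\<theta> anti[of x m] by (auto simp: extends_theta_def)
  have 2: "lbr G m x = - lbr G x m" if "x \<in> carr G" for x
    using that m by (intro lbr_antisym[OF GL]) simp_all
  have c: "act x (\<theta> y m) - act y (\<theta> x m) - \<theta> (lbr G x y) m - \<theta> y (lbr G x m) + \<theta> x (lbr G y m) = 0"
    by (rule theta_cocycle[OF s x m])
  have z: "act m (F [x, y]) = 0" using x m cochain2_in[OF F x] by simp
  show "differential G Z act F [x, y, m] = 0" "differential G Z act F [x, m, y] = 0"
    "differential G Z act F [m, x, y] = 0"
    using x m c by (simp_all add: differential2[OF tZ] 1 2 z algebra_simps)
qed

section \<open>Descent to the quotient by the image of \<open>\<alpha>\<close>\<close>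

lemma q_simps:
  shows "carr Q = (\<lambda>x. q x) ` carr G"
    and "q x + q y = q (x + y)"
    and "continuous_linear G Q (\<lambda>x. q x)"
    and "q x = q y \<longleftrightarrow> x - y \<in> n"
    and "x \<in> carr G \<Longrightarrow> y \<in> carr G \<Longrightarrow> lbr Q (q x) (q y) = q (lbr G x y)"
    and "x \<in> carr G \<Longrightarrow> z \<in> carr Z \<Longrightarrow> quot_act act (q x) z = act x z"
proof -
  note qs = quot_simps[OF tG subspace_n]
  show "carr Q = (\<lambda>x. q x) ` carr G" "q x + q y = q (x + y)" by (simp_all add: qs)
  show "continuous_linear G Q (\<lambda>x. q x)"
    using linear_map_quot[OF tG subspace_n] by (simp add: linear_map_def)
  show eq: "q x = q y \<longleftrightarrow> x - y \<in> n" for x y by (rule coset_eq_iff[OF tG subspace_n(1)])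
  have rep: "\<exists>m\<in>n. u = x + m" if "u \<in> q x" for u x using that by (auto simp: elt_set_plus_def)
  show "lbr Q (q x) (q y) = q (lbr G x y)" if x: "x \<in> carr G" "y \<in> carr G"
  proof -
    \<comment> \<open>Changing representatives alters the bracket by an element of the ideal, so the
      union defining the quotient bracket runs over equal cosets.\<close>
    have 1: "q (lbr G u v) = q (lbr G x y)" if uv: "u \<in> q x" "v \<in> q y" for u v
    proof -
      obtain m m' where m: "m \<in> n" "m' \<in> n" "u = x + m" "v = y + m'"
        using rep[OF uv(1)] rep[OF uv(2)] by auto
      have "lbr G u v - lbr G x y = lbr G x m' + lbr G m (y + m')"
        using m x by (simp add: base_simps algebra_simps)
      also have "\<dots> \<in> n" using m x by (intro n_closed(2) lbr_n lbr_n') (simp_all add: base_simps)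
      finally show ?thesis by (simp add: eq)
    qed
    have ne: "q x \<noteq> {}" "q y \<noteq> {}" using qs(5) by blast+
    have "(\<Union>v\<in>q y. q (lbr G u v)) = q (lbr G x y)" if "u \<in> q x" for u
      by (rule SUP_eq_const[OF ne(2)]) (rule 1[OF that])
    from SUP_eq_const[OF ne(1) this] show ?thesis by simp
  qed
  show "quot_act act (q x) z = act x z" if x: "x \<in> carr G" "z \<in> carr Z"
  proof -
    \<comment> \<open>The selected representative differs from \<open>x\<close> by an element of the
      image, which acts trivially on the kernel.\<close>
    have "(SOME u. u \<in> q x) \<in> q x" using someI[of "\<lambda>u. u \<in> q x", OF qs(5)] .
    then obtain m where m: "m \<in> n" "(SOME u. u \<in> q x) = x + m" using rep by blast
    show ?thesis unfolding quot_act_def m(2) using m(1) x by (simp add: base_simps)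
  qed
qed

lemma quotient_splitting:
  obtains p \<tau> where "continuous_linear G N p" "\<And>m. m \<in> n \<Longrightarrow> p m = m"
    and "continuous_linear Q G \<tau>" "\<And>x. \<tau> (q x) = x - p x"
proof (rule topologically_split_projection[OF K tG split_n])
  fix P \<sigma>
  assume "continuous_linear G (sub G n) P" "\<And>w. w \<in> n \<Longrightarrow> P w = w"
    and "continuous_linear (quot_tvs G n) G \<sigma>" "\<And>x. \<sigma> (x +o n) = x - P x"
  then show thesis by (intro that[of P \<sigma>]) (simp_all add: im_lie_def linear_map_def)
qed

text \<open>\<open>D\<close> depends only on cosets, and \<open>\<tau> (q x)\<close> differs from
  \<open>x\<close> by \<open>p x\<close> in the image. So the descended cochain is the pullback of
  \<open>D\<close> along the continuous linear section \<open>\<tau>\<close>, which makes its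
  continuity immediate.\<close>

lemma cochain2_descends:
  assumes D: "D \<in> cochains G Z 2" and van: "\<And>x m. x \<in> carr G \<Longrightarrow> m \<in> n \<Longrightarrow> D [x, m] = 0"
  obtains \<gamma> where "\<gamma> \<in> cochains Q Z 2"
    "\<And>x y. x \<in> carr G \<Longrightarrow> y \<in> carr G \<Longrightarrow> \<gamma> [q x, q y] = D [x, y]"
proof -
  obtain p \<tau> where p: "continuous_linear G N p" "\<And>m. m \<in> n \<Longrightarrow> p m = m"
    and \<tau>: "continuous_linear Q G \<tau>" "\<And>x. \<tau> (q x) = x - p x"
    by (rule quotient_splitting, rule that)
  have b: "bilinear_map G G Z (\<lambda>x y. D [x, y])" and a: "\<And>x. x \<in> carr G \<Longrightarrow> D [x, x] = 0"
    using D by (auto simp: cochains2_iff continuous_bilinear_def)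
  have van': "D [m, x] = 0" if "x \<in> carr G" "m \<in> n" for x m
    using alternating_antisym[OF tG b _ that(1), of m] that van by (simp add: a base_simps)
  have "D [x - p x, y - p y] = D [x, y]" if "x \<in> carr G" "y \<in> carr G" for x y
    using that linear_map_in[OF conjunct1[OF p(1)]]
    by (simp add: van van' bilinear_simps[OF tG tG b] base_simps)
  then show ?thesis
    using that[of "\<lambda>xs. D (map \<tau> xs)"] cochains_pullback[OF \<tau>(1) D] by (simp add: \<tau>(2))
qed

lemma cochain3_descends:
  assumes D: "D \<in> cochains G Z 3"
    and van: "\<And>x y m. x \<in> carr G \<Longrightarrow> y \<in> carr G \<Longrightarrow> m \<in> n \<Longrightarrow>
      D [x, y, m] = 0 \<and> D [x, m, y] = 0 \<and> D [m, x, y] = 0"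
  obtains \<beta> where "\<beta> \<in> cochains Q Z 3"
    "\<And>x y z. x \<in> carr G \<Longrightarrow> y \<in> carr G \<Longrightarrow> z \<in> carr G \<Longrightarrow> \<beta> [q x, q y, q z] = D [x, y, z]"
proof -
  obtain p \<tau> where p: "continuous_linear G N p" "\<And>m. m \<in> n \<Longrightarrow> p m = m"
    and \<tau>: "continuous_linear Q G \<tau>" "\<And>x. \<tau> (q x) = x - p x"
    by (rule quotient_splitting, rule that)
  note [simp] = linear_map_simps(3)[OF tG cochain3D(1)[OF D]]
    linear_map_simps(3)[OF tG cochain3D(2)[OF D]] linear_map_simps(3)[OF tG cochain3D(3)[OF D]]
  have "D [x - p x, y - p y, z - p z] = D [x, y, z]"
    if "x \<in> carr G" "y \<in> carr G" "z \<in> carr G" for x y z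
    using that linear_map_in[OF conjunct1[OF p(1)]] by (simp add: van base_simps)
  then show ?thesis
    using that[of "\<lambda>xs. D (map \<tau> xs)"] cochains_pullback[OF \<tau>(1) D] by (simp add: \<tau>(2))
qed

lemma tuples_Q:
  "xs \<in> tuples Q 3 \<Longrightarrow> \<exists>x\<in>carr G. \<exists>y\<in>carr G. \<exists>z\<in>carr G. xs = [q x, q y, q z]"
  "xs \<in> tuples Q 4 \<Longrightarrow> \<exists>x\<in>carr G. \<exists>y\<in>carr G. \<exists>z\<in>carr G. \<exists>w\<in>carr G. xs = [q x, q y, q z, q w]"
  unfolding tuples_iff q_simps(1) by blast+

lemma q_in: "x \<in> carr G \<Longrightarrow> q x \<in> carr Q"
  unfolding q_simps(1) by (rule imageI)

text \<open>Pullback along \<open>q\<close> is a chain map, because \<open>q\<close> preserves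
  brackets and \<open>q x\<close> acts on the kernel as \<open>x\<close> does.\<close>

lemma differential2_q:
  assumes \<gamma>: "\<gamma> \<in> cochains Q Z 2" and x: "x \<in> carr G" "y \<in> carr G" "z \<in> carr G"
  shows "differential Q Z (quot_act act) \<gamma> [q x, q y, q z] =
    differential G Z act (\<lambda>xs. \<gamma> (map (\<lambda>x. q x) xs)) [x, y, z]"
  using x cochain2_in[OF \<gamma> q_in q_in]
  by (simp add: differential2[OF tZ] q_simps(5,6) del: quot_lie_simps)

text \<open>Every element of the quotient is a coset \<open>q x\<close>, so the differential of
  \<open>\<beta>\<close> is determined by its pullback to \<open>G\<close>, which is
  \<open>d (d F) = 0\<close>.\<close>

lemma cocycle3_descends:
  assumes F: "F \<in> cochains G Z 2" and \<beta>: "\<beta> \<in> cochains Q Z 3"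
    and eq: "\<And>x y z. x \<in> carr G \<Longrightarrow> y \<in> carr G \<Longrightarrow> z \<in> carr G \<Longrightarrow>
      \<beta> [q x, q y, q z] = differential G Z act F [x, y, z]"
  shows "\<beta> \<in> cocycles Q Z (quot_act act) 3"
proof -
  have in_Z: "differential G Z act F [x, y, z] \<in> carr Z"
    if "x \<in> carr G" "y \<in> carr G" "z \<in> carr G" for x y z
    using linear_map_in[OF cochain3D(1)[OF differential_cochain2[OF K GL ZM F]]] that by blast
  have "differential Q Z (quot_act act) \<beta> [q x, q y, q z, q w] = 0"
    if x: "x \<in> carr G" "y \<in> carr G" "z \<in> carr G" "w \<in> carr G" for x y z w
  proof -
    have "differential Q Z (quot_act act) \<beta> [q x, q y, q z, q w] =
        differential G Z act (differential G Z act F) [x, y, z, w]"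
      using x by (simp add: differential3[OF tZ] q_simps(5,6) eq in_Z
          bilinear_simps(1)[OF tG tG tla_bilinear[OF GL]] del: quot_lie_simps)
    then show ?thesis using differential_differential2[OF GL ZM F x] by simp
  qed
  then have "differential Q Z (quot_act act) \<beta> xs = 0" if "xs \<in> tuples Q 4" for xs
    using tuples_Q(2)[OF that] by blast
  then show ?thesis using \<beta> by (simp add: cocycles_def)
qed

section \<open>The characteristic class\<close>

lemma char_cocycle_exists:
  assumes pr: "presentation H G act \<alpha> f \<theta> \<Phi>"
    and F: "F \<in> cochains G Z 2" "extends_theta H G \<alpha> \<theta> F"
  obtains \<beta> where "char_cocycle H G act \<alpha> \<beta>"
    "\<And>x y z. x \<in> carr G \<Longrightarrow> y \<in> carr G \<Longrightarrow> z \<in> carr G \<Longrightarrow>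
      \<beta> [q x, q y, q z] = differential G Z act F [x, y, z]"
proof -
  note s = presentation_sect[OF pr]
  obtain \<beta> where \<beta>: "\<beta> \<in> cochains Q Z 3"
    "\<And>x y z. x \<in> carr G \<Longrightarrow> y \<in> carr G \<Longrightarrow> z \<in> carr G \<Longrightarrow>
      \<beta> [q x, q y, q z] = differential G Z act F [x, y, z]"
    using cochain3_descends[OF differential_cochain2[OF K GL ZM F(1)]]
      differential_vanishes[OF s F] by metis
  moreover have "\<beta> \<in> cocycles Q Z (quot_act act) 3"
    by (rule cocycle3_descends[OF F(1) \<beta>])
  moreover have "\<forall>xs\<in>tuples G 3. differential G Z act F xs = \<beta> (map (\<lambda>x. q x) xs)"
    using \<beta>(2) by (auto simp: tuples_iff)
  ultimately show ?thesis
    using that pr F unfolding char_cocycle_def Let_def by blast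
qed

lemma char_cocycle_unique:
  assumes "char_cocycle H G act \<alpha> \<beta>" "char_cocycle H G act \<alpha> \<beta>'"
  shows "(\<lambda>xs. \<beta> xs - \<beta>' xs) \<in> coboundaries Q Z (quot_act act) 3"
proof -
  obtain f \<theta> \<Phi> F where pr: "presentation H G act \<alpha> f \<theta> \<Phi>"
    and F: "F \<in> cochains G Z 2" "extends_theta H G \<alpha> \<theta> F"
    and \<beta>: "\<beta> \<in> cocycles Q Z (quot_act act) 3"
      "\<And>xs. xs \<in> tuples G 3 \<Longrightarrow> differential G Z act F xs = \<beta> (map (\<lambda>x. q x) xs)"
    using assms(1) unfolding char_cocycle_def Let_def by blast
  obtain f' \<theta>' \<Phi>' F' where pr': "presentation H G act \<alpha> f' \<theta>' \<Phi>'"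
    and F': "F' \<in> cochains G Z 2" "extends_theta H G \<alpha> \<theta>' F'"
    and \<beta>': "\<beta>' \<in> cocycles Q Z (quot_act act) 3"
      "\<And>xs. xs \<in> tuples G 3 \<Longrightarrow> differential G Z act F' xs = \<beta>' (map (\<lambda>x. q x) xs)"
    using assms(2) unfolding char_cocycle_def Let_def by blast
  obtain s s' where s: "sect s \<theta>" "sect s' \<theta>'"
    using presentation_sect[OF pr] presentation_sect[OF pr'] by blast
  obtain p \<tau> where p: "continuous_linear G N p" "\<And>m. m \<in> n \<Longrightarrow> p m = m"
    by (rule quotient_splitting, rule that)
  have p_in: "p x \<in> n" if "x \<in> carr G" for x
    using linear_map_in[OF conjunct1[OF p(1)] that] by (simp add: carr_N)
  \<comment> \<open>The difference of the two sections, extended to \<open>G\<close> through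
    \<open>p\<close>. Both are sections of \<open>\<alpha>\<close>, so the values lie in the
    kernel.\<close>
  define l where "l x = s (p x) - s' (p x)" for x
  have sN: "continuous_linear N H s" "continuous_linear N H s'" using s by (simp_all add: sect_def)
  note ss = sect_simps[OF s(1)] sect_simps[OF s(2)]
  have l_in: "l x \<in> carr Z" if "x \<in> carr G" for x
    using p_in[OF that] unfolding l_def by (intro in_ZI) (simp_all add: base_simps ss)
  have "linear_map G H l"
    unfolding l_def using p(1) sN by (intro linear_map_diff[OF tH] linear_map_comp[of G N p H]) auto
  then have l: "linear_map G Z l"
    using l_in by (auto simp: linear_map_def)
  have "continuous_map (vtop G) (vtop H) l"
    unfolding l_def
    using continuous_map_tvs_diff[OF K tH
        continuous_map_compose[OF conjunct2[OF p(1)] conjunct2[OF sN(1)]]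
        continuous_map_compose[OF conjunct2[OF p(1)] conjunct2[OF sN(2)]]] by (simp add: o_def)
  then have lc: "continuous_map (vtop G) (vtop Z) l"
    using l_in by (auto simp: vtop_Z carr_Z continuous_map_in_subtopology)
  note [simp] = base_simps linear_map_simps[OF tG l, unfolded vscale_Z]
  have aZ: "act x (z - z') = act x z - act x z'" "act x (z + z') = act x z + act x z'" 
    "act x (vscale H c z) = vscale H c (act x z)"
    if "x \<in> carr G" "z \<in> carr Z" "z' \<in> carr Z" for x z z' c
    using that by simp_all

  \<comment> \<open>\<open>D\<close> is \<open>F - F'\<close> minus the differential of the
    one-cochain \<open>l\<close>, written out.\<close>
  define D where "D xs = F xs - F' xs - (act (xs ! 0) (l (xs ! 1)) - act (xs ! 1) (l (xs ! 0))
      - l (lbr G (xs ! 0) (xs ! 1)))" for xs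
  have lbG: "continuous_bilinear G G G (lbr G)" and aZc: "continuous_bilinear G Z Z act"
    using GL ZM by (simp_all add: topological_lie_algebra_def topological_module_def)
  have dl: "(\<lambda>xs. act (xs ! 0) (l (xs ! 1)) - act (xs ! 1) (l (xs ! 0)) - l (lbr G (xs ! 0) (xs ! 1)))
      \<in> cochains G Z 2"
    unfolding cochains2_iff continuous_bilinear_def
  proof (intro conjI ballI)
    let ?P = "prod_topology (vtop G) (vtop G)"
    show "bilinear_map G G Z (\<lambda>x y. act ([x, y] ! 0) (l ([x, y] ! 1)) - act ([x, y] ! 1) (l ([x, y] ! 0))
        - l (lbr G ([x, y] ! 0) ([x, y] ! 1)))"
      unfolding bilinear_map_def by (auto intro!: linear_mapI simp: algebra_simps)
    have "continuous_map ?P (vtop Z) (\<lambda>a. act (fst a) (l (snd a)) - act (snd a) (l (fst a))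
        - l (lbr G (fst a) (snd a)))"
      using continuous_map_compose[OF continuous_bilinear_compose[OF lbG continuous_map_fst continuous_map_snd] lc]
      by (intro continuous_map_tvs_diff[OF K tZ] continuous_bilinear_compose[OF aZc]
          continuous_map_fst continuous_map_snd continuous_map_prod_fst_snd lc) (simp add: o_def)
    then show "continuous_map ?P (vtop Z) (\<lambda>(x, y). act ([x, y] ! 0) (l ([x, y] ! 1))
        - act ([x, y] ! 1) (l ([x, y] ! 0)) - l (lbr G ([x, y] ! 0) ([x, y] ! 1)))"
      by (simp add: case_prod_unfold)
    show "act ([x, x] ! 0) (l ([x, x] ! 1)) - act ([x, x] ! 1) (l ([x, x] ! 0))
        - l (lbr G ([x, x] ! 0) ([x, x] ! 1)) = 0" if "x \<in> carr G" for x
      using that GL by (simp add: topological_lie_algebra_def)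
  qed
  have D: "D \<in> cochains G Z 2"
    unfolding D_def by (rule cochains_diff[OF K tZ cochains_diff[OF K tZ F(1) F'(1)] dl])
  \<comment> \<open>Subtracting the two formulas for \<open>act x (s m)\<close> and
    \<open>act x (s' m)\<close> gives
    \<open>\<theta> x m - \<theta>' x m = act x (l m) - l (lbr G x m)\<close>, which is the
    correction subtracted in \<open>D\<close>.\<close>
  have "D [x, m] = 0" if "x \<in> carr G" "m \<in> n" for x m
  proof -
    have "act x (l m) = act x (s m) - act x (s' m)"
      using that by (simp add: l_def p(2) ss(1,18))
    moreover have "F [x, m] = \<theta> x m" "F' [x, m] = \<theta>' x m"
      using F(2) F'(2) that by (auto simp: extends_theta_def)
    moreover have "act m (l x) = 0" "l (lbr G x m) = s (lbr G x m) - s' (lbr G x m)"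
      using that l_in by (simp_all add: l_def p(2))
    ultimately show ?thesis
      using that by (simp add: D_def ss)
  qed
  then obtain \<gamma> where \<gamma>: "\<gamma> \<in> cochains Q Z 2"
    "\<And>x y. x \<in> carr G \<Longrightarrow> y \<in> carr G \<Longrightarrow> \<gamma> [q x, q y] = D [x, y]"
    using cochain2_descends[OF D] by blast
  have "\<beta> xs - \<beta>' xs = differential Q Z (quot_act act) \<gamma> xs" if xsQ: "xs \<in> tuples Q 3" for xs
  proof -
    obtain x y z where x: "x \<in> carr G" "y \<in> carr G" "z \<in> carr G" and xs: "xs = [q x, q y, q z]"
      using tuples_Q(1)[OF xsQ] by blast
    have "\<beta> xs = differential G Z act F [x, y, z]" "\<beta>' xs = differential G Z act F' [x, y, z]"
      using \<beta>(2)[of "[x, y, z]"] \<beta>'(2)[of "[x, y, z]"] x by (simp_all add: tuples_iff xs)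
    moreover have "differential Q Z (quot_act act) \<gamma> xs = differential G Z act D [x, y, z]"
      unfolding xs differential2_q[OF \<gamma>(1) x] using x by (simp add: differential2[OF tZ] \<gamma>(2))
    \<comment> \<open>The differential of the correction is \<open>d (d l) = 0\<close>, by the
      representation property and Jacobi.\<close>
    moreover have "differential G Z act D [x, y, z] =
        differential G Z act F [x, y, z] - differential G Z act F' [x, y, z]"
    proof -
      have "l (lbr G (lbr G x y) z) = l (lbr G (lbr G x z) y) - l (lbr G (lbr G y z) x)"
        using lbr_jacobi[OF GL x] x by simp
      then show ?thesis
        using x cochain2_in[OF F(1)] cochain2_in[OF F'(1)] l_in
        by (simp add: differential2[OF tZ] D_def act_cocycle algebra_simps)
    qed
    ultimately show ?thesis by simp
  qed
  then show ?thesis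
    unfolding coboundaries3_iff
    using \<gamma>(1) cochains_diff[OF K tZ] \<beta>(1) \<beta>'(1) unfolding cocycles_def by blast
qed

lemma act_Q_diff:
  "X \<in> carr Q \<Longrightarrow> v \<in> carr Z \<Longrightarrow> w \<in> carr Z \<Longrightarrow>
     quot_act act X (v - w) = quot_act act X v - quot_act act X w"
  unfolding q_simps(1) by (auto simp: q_simps(6) base_simps)

lemma H3_class_eq_iff:
  assumes "\<beta> \<in> cocycles Q Z (quot_act act) 3" "\<beta>' \<in> cocycles Q Z (quot_act act) 3"
  shows "H3_class H G act \<alpha> \<beta> = H3_class H G act \<alpha> \<beta>' \<longleftrightarrow>
    (\<lambda>xs. \<beta> xs - \<beta>' xs) \<in> coboundaries Q Z (quot_act act) 3"
  unfolding H3_class_def by (rule cohomology_class3_eq_iff[OF K tZ act_Q_diff assms])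

lemma char_cocycle_cocycle: "char_cocycle H G act \<alpha> \<beta> \<Longrightarrow> \<beta> \<in> cocycles Q Z (quot_act act) 3"
  unfolding char_cocycle_def Let_def by blast

lemma zero_cocycle3: "(\<lambda>_. 0) \<in> cocycles Q Z (quot_act act) 3"
proof -
  have "differential Q Z (quot_act act) (\<lambda>_. 0) xs = 0" if "xs \<in> tuples Q 4" for xs
    using tuples_Q(2)[OF that]
    by (auto simp: differential3[OF tZ] q_simps(6) base_simps simp del: quot_lie_simps)
  then show ?thesis
    using cochains_zero[OF tZ] by (simp add: cocycles_def)
qed

text \<open>The definite description denotes because \<open>char_cocycle_unique\<close> makes all
  characteristic cocycles cohomologous.\<close>

lemma char_class_eq:
  assumes "char_cocycle H G act \<alpha> \<beta>"
  shows "char_class H G act \<alpha> = H3_class H G act \<alpha> \<beta>"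
  unfolding char_class_def
proof (rule the_equality)
  show "\<exists>\<beta>'. char_cocycle H G act \<alpha> \<beta>' \<and> H3_class H G act \<alpha> \<beta> = H3_class H G act \<alpha> \<beta>'"
    using assms by blast
  fix c assume "\<exists>\<beta>'. char_cocycle H G act \<alpha> \<beta>' \<and> c = H3_class H G act \<alpha> \<beta>'"
  then obtain \<beta>' where \<beta>': "char_cocycle H G act \<alpha> \<beta>'" "c = H3_class H G act \<alpha> \<beta>'" by blast
  then show "c = H3_class H G act \<alpha> \<beta>"
    using H3_class_eq_iff[OF char_cocycle_cocycle[OF \<beta>'(1)] char_cocycle_cocycle[OF assms]]
      char_cocycle_unique[OF \<beta>'(1) assms] by simp
qed

text \<open>\<open>d F = 0\<close> is the pullback of zero, so the zero cochain is itself a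
  characteristic cocycle.\<close>

lemma char_class_zeroI:
  assumes pr: "presentation H G act \<alpha> f \<theta> \<Phi>"
    and F: "F \<in> cocycles G Z act 2" "extends_theta H G \<alpha> \<theta> F"
  shows "char_class H G act \<alpha> = H3_class H G act \<alpha> (\<lambda>_. 0)"
proof -
  have "char_cocycle H G act \<alpha> (\<lambda>_. 0)"
    unfolding char_cocycle_def Let_def
    using pr F zero_cocycle3 by (intro exI[of _ f] exI[of _ \<theta>] exI[of _ \<Phi>] exI[of _ F])
      (auto simp: cocycles_def)
  then show ?thesis by (rule char_class_eq)
qed

lemma char_class_zeroD:
  assumes zero: "char_class H G act \<alpha> = H3_class H G act \<alpha> (\<lambda>_. 0)"
    and pr: "presentation H G act \<alpha> f \<theta> \<Phi>"
  shows "\<exists>F\<in>cocycles G Z act 2. extends_theta H G \<alpha> \<theta> F"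
proof -
  note s = presentation_sect[OF pr]
  obtain F where F: "F \<in> cochains G Z 2" "extends_theta H G \<alpha> \<theta> F"
    using theta_extends[OF s] by blast
  obtain \<beta> where cc: "char_cocycle H G act \<alpha> \<beta>"
    and \<beta>: "\<And>x y z. x \<in> carr G \<Longrightarrow> y \<in> carr G \<Longrightarrow> z \<in> carr G \<Longrightarrow>
      \<beta> [q x, q y, q z] = differential G Z act F [x, y, z]"
    by (rule char_cocycle_exists[OF pr F], rule that)
  have "\<beta> \<in> coboundaries Q Z (quot_act act) 3"
    using H3_class_eq_iff[OF char_cocycle_cocycle[OF cc] zero_cocycle3] zero
    by (simp add: char_class_eq[OF cc])
  then obtain \<gamma> where \<gamma>: "\<gamma> \<in> cochains Q Z 2"
    and \<beta>\<gamma>: "\<And>xs. xs \<in> tuples Q 3 \<Longrightarrow> \<beta> xs = differential Q Z (quot_act act) \<gamma> xs"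
    unfolding coboundaries3_iff by blast
  \<comment> \<open>A primitive of \<open>\<beta>\<close>, pulled back to \<open>G\<close>, has the
    same differential as \<open>F\<close>; subtracting it yields a cocycle.\<close>
  define \<gamma>' where "\<gamma>' xs = \<gamma> (map (\<lambda>x. q x) xs)" for xs
  have \<gamma>': "\<gamma>' \<in> cochains G Z 2"
    unfolding \<gamma>'_def by (rule cochains_pullback[OF q_simps(3) \<gamma>])
  have "differential G Z act (\<lambda>xs. F xs - \<gamma>' xs) [x, y, z] = 0"
    if x: "x \<in> carr G" "y \<in> carr G" "z \<in> carr G" for x y z
  proof -
    have "[q x, q y, q z] \<in> tuples Q 3" using x q_in unfolding tuples_iff by blast
    then have "differential G Z act F [x, y, z] = differential G Z act \<gamma>' [x, y, z]"
      using \<beta>[OF x] \<beta>\<gamma> differential2_q[OF \<gamma> x] by (simp add: \<gamma>'_def[abs_def])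
    then show ?thesis
      using x cochain2_in[OF F(1)] cochain2_in[OF \<gamma>']
      by (simp add: differential2[OF tZ] base_simps algebra_simps)
  qed
  then have "(\<lambda>xs. F xs - \<gamma>' xs) \<in> cocycles G Z act 2"
    using cochains_diff[OF K tZ F(1) \<gamma>'] by (auto simp: cocycles_def tuples_iff)
  moreover have "extends_theta H G \<alpha> \<theta> (\<lambda>xs. F xs - \<gamma>' xs)"
  proof -
    have "\<gamma>' [x, m] = 0" if "x \<in> carr G" "m \<in> n" for x m
    proof -
      have b: "bilinear_map G G Z (\<lambda>x y. \<gamma>' [x, y])"
        using \<gamma>' by (simp add: cochains2_iff continuous_bilinear_def)
      \<comment> \<open>The correction depends only on cosets and \<open>m\<close> lies in the coset
        of \<open>0\<close>, so it leaves the values prescribed by \<open>\<theta>\<close>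
        unchanged.\<close>
      have "q m = q 0" using that(2) unfolding q_simps(4) by simp
      then have "\<gamma>' [x, m] = \<gamma>' [x, 0]" unfolding \<gamma>'_def by simp
      also have "\<dots> = 0" using bilinear_simps(5)[OF tG tG b that(1)] .
      finally show ?thesis .
    qed
    then show ?thesis using F(2) unfolding extends_theta_def carr_N by auto
  qed
  ultimately show ?thesis by blast
qed

section \<open>Correspondence with abelian extensions\<close>

lemma twisted_sum_equivariant_equivalence:
  assumes s: "sect s \<theta>" and F: "F \<in> cocycles G Z act 2" "extends_theta H G \<alpha> \<theta> F"
  shows "equivariant_equivalence H act \<alpha> (twisted_sum Z G act F) (\<lambda>a. (a, 0)) snd
    (\<lambda>h. (h - s (\<alpha> h), \<alpha> h))"
proof -
  \<comment> \<open>The map writes \<open>h = z + s m\<close> as \<open>(z, m)\<close>. The bracket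
    of \<open>(a, x)\<close> with \<open>(z, m)\<close> has first component
    \<open>act x z + \<theta> x m\<close>, since \<open>m\<close> acts trivially on
    \<open>a\<close>; this matches the action of \<open>x\<close> on \<open>h\<close>.\<close>
  let ?E = "twisted_sum Z G act F" and ?\<phi> = "\<lambda>h. (h - s (\<alpha> h), \<alpha> h)"
  let ?S = "{e \<in> carr ?E. snd e \<in> n}"
  let ?T = "subtopology (prod_topology (vtop Z) (vtop G)) ?S"
  note [simp] = base_simps sect_simps[OF s]
  have sc: "continuous_map (vtop N) (vtop H) s" using s by (simp add: sect_def)
  have F\<theta>: "F [x, m] = \<theta> x m" if "x \<in> carr G" "m \<in> n" for x m
    using F(2) that by (auto simp: extends_theta_def)
  have z_in: "h - s (\<alpha> h) \<in> carr Z" if "h \<in> carr H" for h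
    by (rule in_ZI) (use that in simp_all)
  have eqv: "?\<phi> (act (snd e) h) = lbr ?E e (?\<phi> h)" if e: "e \<in> carr ?E" and h: "h \<in> carr H" for e h
  proof -
    obtain a x where x: "e = (a, x)" "a \<in> carr Z" "x \<in> carr G" using e by auto
    then show ?thesis
      using x h by (simp add: F\<theta> z_in)
  qed
  have lin: "linear_map H (sub ?E ?S) ?\<phi>"
    by (rule linear_mapI) (simp_all add: z_in)
  have \<alpha>N: "continuous_map (vtop H) (vtop N) \<alpha>"
    unfolding vtop_N using \<alpha> by (auto simp: continuous_map_in_subtopology)
  have "continuous_map (vtop H) (vtop H) (\<lambda>h. h - s (\<alpha> h))"
    using continuous_map_compose[OF \<alpha>N sc]
    by (intro continuous_map_tvs_diff[OF K tH] continuous_map_id[unfolded id_def]) (simp add: o_def)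
  then have "continuous_map (vtop H) (vtop Z) (\<lambda>h. h - s (\<alpha> h))"
    unfolding vtop_Z by (auto simp: continuous_map_in_subtopology)
  then have c: "continuous_map (vtop H) ?T ?\<phi>"
    using \<alpha> z_in by (auto simp: continuous_map_in_subtopology intro: continuous_map_pairedI)
  have "continuous_map ?T (vtop H) fst"
    using continuous_map_from_subtopology[OF continuous_map_fst[of "vtop Z" "vtop G"], of ?S]
    unfolding vtop_Z by (blast dest: continuous_map_into_fulltopology)
  moreover have "continuous_map ?T (vtop N) snd"
    unfolding vtop_N using continuous_map_from_subtopology[OF continuous_map_snd]
    by (auto simp: continuous_map_in_subtopology)
  from continuous_map_compose[OF this sc] have "continuous_map ?T (vtop H) (\<lambda>p. s (snd p))"
    by (simp add: o_def)
  ultimately have "continuous_map ?T (vtop H) (\<lambda>p. fst p + s (snd p))"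
    by (rule continuous_map_tvs_add[OF tH])
  with c have "homeomorphic_maps (vtop H) ?T ?\<phi> (\<lambda>p. fst p + s (snd p))"
    unfolding homeomorphic_maps_def by auto
  then have hm: "homeomorphic_map (vtop H) ?T ?\<phi>" using homeomorphic_map_maps by blast
  \<comment> \<open>Compatibility with brackets is equivariance at \<open>e = ?\<phi> h\<close>,
    because \<open>\<alpha> h\<close> acts on \<open>H\<close> as the bracket with
    \<open>h\<close>.\<close>
  have br: "?\<phi> (lbr H h h') = lbr (sub ?E ?S) (?\<phi> h) (?\<phi> h')" if "h \<in> carr H" "h' \<in> carr H" for h h'
    using eqv[of "?\<phi> h" h'] that act_\<alpha>[of h h'] by (simp add: z_in)
  have top: "vtop (sub ?E ?S) = ?T" by simp
  have iso: "lie_iso H (sub ?E ?S) ?\<phi>"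
    unfolding lie_iso_def lie_morphism_def top by (intro conjI ballI lin c hm br)
  show ?thesis
    unfolding equivariant_equivalence_def by (intro conjI ballI iso eqv) simp_all
qed

text \<open>The section of \<open>q\<close> is chosen to restrict to \<open>\<phi> \<circ> s\<close> on \<open>im \<alpha>\<close>; by equivariance the
  resulting cocycle then extends \<open>\<theta>\<close>.\<close>

lemma extension_cocycle:
  fixes E :: "('k, 'e::ab_group_add) tla"
  assumes s: "sect s \<theta>" and ext': "split_abelian_extension K Z act E G \<iota> r"
    and eq: "equivariant_equivalence H act \<alpha> E \<iota> r \<phi>"
  shows "\<exists>F\<in>cocycles G Z act 2. extends_theta H G \<alpha> \<theta> F"
proof -
  let ?S = "{e \<in> carr E. r e \<in> n}"
  have EL: "topological_lie_algebra K E" and r: "linear_map E G r" and \<iota>: "linear_map Z E \<iota>"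
    and em: "embedding_map (vtop Z) (vtop E) \<iota>"
    using ext' by (auto simp: split_abelian_extension_def lie_morphism_def)
  note tE = tla_tvs[OF EL]
  have \<phi>S: "continuous_linear H (sub E ?S) \<phi>" and \<phi>Z: "\<And>z. z \<in> carr Z \<Longrightarrow> \<phi> z = \<iota> z"
    and r\<phi>: "\<And>h. h \<in> carr H \<Longrightarrow> r (\<phi> h) = \<alpha> h"
    and eqv: "\<And>e h. e \<in> carr E \<Longrightarrow> h \<in> carr H \<Longrightarrow> \<phi> (act (r e) h) = lbr E e (\<phi> h)"
    using eq by (auto simp: equivariant_equivalence_def lie_iso_def lie_morphism_def)
  have \<phi>: "continuous_linear H E \<phi>"
    using \<phi>S by (auto simp: linear_map_def continuous_map_in_subtopology)
  obtain t where t: "continuous_linear G E t" "\<And>x. x \<in> carr G \<Longrightarrow> r (t x) = x"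
    using split_extension_section[OF K ext'] by blast
  obtain p \<tau>0 where p: "continuous_linear G N p" "\<And>m. m \<in> n \<Longrightarrow> p m = m"
    by (rule quotient_splitting, rule that)
  have pG: "continuous_linear G G p"
    using p(1) by (auto simp: im_lie_def linear_map_def continuous_map_in_subtopology)
  have p_in: "p x \<in> n" if "x \<in> carr G" for x
    using linear_map_in[OF conjunct1[OF p(1)] that] by (simp add: carr_N)
  have sN: "continuous_linear N H s" using s by (simp add: sect_def)
  \<comment> \<open>\<open>t\<close> is an arbitrary section of \<open>r\<close>. It is applied only
    to \<open>x - p x\<close>, which is zero for \<open>x\<close> in the image.\<close>
  define \<tau> where "\<tau> x = t (x - p x) + \<phi> (s (p x))" for x
  note [simp] = base_simps sect_simps[OF s] tvs_simps[OF tE] linear_map_simps[OF tE r]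
    linear_map_simps[OF tH conjunct1[OF \<phi>]] linear_map_simps[OF tG conjunct1[OF t(1)]] t(2) r\<phi> p(2) p_in
  have "linear_map G G (\<lambda>x. x)" by (simp add: linear_map_def)
  from linear_map_comp[OF linear_map_diff[OF tG this conjunct1[OF pG]] conjunct1[OF t(1)]]
    linear_map_comp[OF linear_map_comp[OF conjunct1[OF p(1)] conjunct1[OF sN]] conjunct1[OF \<phi>]]
  have "linear_map G E \<tau>"
    unfolding \<tau>_def by (rule linear_map_add[OF tE])
  moreover have "continuous_map (vtop G) (vtop E) \<tau>"
  proof -
    have "continuous_map (vtop G) (vtop G) (\<lambda>x. x - p x)"
      using pG by (intro continuous_map_tvs_diff[OF K tG] continuous_map_id[unfolded id_def]) auto
    from continuous_map_compose[OF this conjunct2[OF t(1)]]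
      continuous_map_compose[OF continuous_map_compose[OF conjunct2[OF p(1)] conjunct2[OF sN]] conjunct2[OF \<phi>]]
    show ?thesis
      unfolding \<tau>_def by (intro continuous_map_tvs_add[OF tE]) (simp_all add: o_def)
  qed
  ultimately have \<tau>: "continuous_linear G E \<tau>" by blast
  have r\<tau>: "r (\<tau> x) = x" if "x \<in> carr G" for x
    using that by (simp add: \<tau>_def)
  obtain F where F: "F \<in> cocycles G Z act 2"
    and \<iota>F: "\<And>x y. x \<in> carr G \<Longrightarrow> y \<in> carr G \<Longrightarrow> \<iota> (F [x, y]) = lbr E (\<tau> x) (\<tau> y) - \<tau> (lbr G x y)"
    using section_cocycle[OF K ext' GL ZM \<tau> r\<tau>] by metis
  have "F [x, m] = \<theta> x m" if x: "x \<in> carr G" "m \<in> n" for x m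
  proof -
    have \<tau>m: "\<tau> m = \<phi> (s m)" if "m \<in> n" for m using that by (simp add: \<tau>_def)
    have "\<iota> (F [x, m]) = lbr E (\<tau> x) (\<phi> (s m)) - \<phi> (s (lbr G x m))"
      using x by (simp add: \<iota>F \<tau>m)
    \<comment> \<open>Since \<open>r (\<tau> x) = x\<close>, equivariance turns the bracket with
      \<open>\<tau> x\<close> into the action of \<open>x\<close>.\<close>
    also have "lbr E (\<tau> x) (\<phi> (s m)) = \<phi> (act x (s m))"
      using eqv[of "\<tau> x" "s m"] x linear_map_in[OF conjunct1[OF \<tau>]] r\<tau> by simp
    also have "\<dots> - \<phi> (s (lbr G x m)) = \<iota> (\<theta> x m)"
      using x by (simp flip: \<phi>Z)
    finally have "\<iota> (F [x, m]) = \<iota> (\<theta> x m)" .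
    moreover have "inj_on \<iota> (carr Z)"
      using em by (simp add: embedding_map_def homeomorphic_imp_injective_map)
    moreover have "F [x, m] \<in> carr Z"
      using cochain2_in[OF cocycle2D(1)[OF F tZ]] x by simp
    ultimately show ?thesis using x by (simp add: inj_on_def)
  qed
  then have "extends_theta H G \<alpha> \<theta> F" unfolding extends_theta_def carr_N by blast
  with F show ?thesis by blast
qed

text \<open>The class vanishes as soon as \<open>\<theta>\<close> extends to a cocycle for a single
  presentation, and one always exists.\<close>

lemma char_class_zero_of_extension:
  fixes E :: "('k, 'e::ab_group_add) tla"
  assumes "split_abelian_extension K Z act E G \<iota> r" "equivariant_equivalence H act \<alpha> E \<iota> r \<phi>"
  shows "char_class H G act \<alpha> = H3_class H G act \<alpha> (\<lambda>_. 0)"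
proof -
  obtain f \<theta> \<Phi> where pr: "presentation H G act \<alpha> f \<theta> \<Phi>" using presentation_exists by blast
  then show ?thesis
    using extension_cocycle[OF presentation_sect[OF pr] assms] char_class_zeroI by blast
qed

text \<open>The witness is the twisted sum of the kernel and \<open>G\<close> by a cocycle extending
  \<open>\<theta>\<close>, which explains the ambient type.\<close>

lemma extension_of_char_class_zero:
  assumes "char_class H G act \<alpha> = H3_class H G act \<alpha> (\<lambda>_. 0)"
  shows "\<exists>(E :: ('k, 'h \<times> 'g) tla) \<iota> r \<phi>.
    split_abelian_extension K Z act E G \<iota> r \<and> equivariant_equivalence H act \<alpha> E \<iota> r \<phi>"
proof -
  obtain f \<theta> \<Phi> where pr: "presentation H G act \<alpha> f \<theta> \<Phi>" using presentation_exists by blast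
  obtain F where F: "F \<in> cocycles G Z act 2" "extends_theta H G \<alpha> \<theta> F"
    using char_class_zeroD[OF assms pr] by blast
  show ?thesis
    using twisted_sum_extension[OF K GL ZM F(1)]
      twisted_sum_equivariant_equivalence[OF presentation_sect[OF pr] F] by blast
qed

end


section \<open>Equivalence of the three conditions\<close>

theorem mainTheorem2:
  fixes K :: "'k::field_char_0 topology"
    and H :: "('k, 'h::ab_group_add) tla"
    and G :: "('k, 'g::ab_group_add) tla"
    and act :: "'g \<Rightarrow> 'h \<Rightarrow> 'h"
    and \<alpha> :: "'h \<Rightarrow> 'g"
  assumes "topological_field K"
    and "split_crossed_module K H G act \<alpha>"
  shows
    "(char_class H G act \<alpha> = H3_class H G act \<alpha> (\<lambda>_. 0) \<longleftrightarrow>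
        (\<forall>f \<theta> \<Phi>. presentation H G act \<alpha> f \<theta> \<Phi> \<longrightarrow>
           (\<exists>F\<in>cocycles G (ker_mod H \<alpha>) act 2. extends_theta H G \<alpha> \<theta> F))) \<and>
     (char_class H G act \<alpha> = H3_class H G act \<alpha> (\<lambda>_. 0) \<longleftrightarrow>
        (\<exists>(E :: ('k, 'h \<times> 'g) tla) \<iota> q \<phi>.
           split_abelian_extension K (ker_mod H \<alpha>) act E G \<iota> q \<and>
           equivariant_equivalence H act \<alpha> E \<iota> q \<phi>)) \<and>
     (\<forall>(E :: ('k, 'e::ab_group_add) tla) \<iota> q \<phi>.
        split_abelian_extension K (ker_mod H \<alpha>) act E G \<iota> q \<and>
        equivariant_equivalence H act \<alpha> E \<iota> q \<phi> \<longrightarrow>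
        char_class H G act \<alpha> = H3_class H G act \<alpha> (\<lambda>_. 0))"
proof -
  interpret split_xmod K H G act \<alpha>
    using assms by unfold_locales (simp_all add: topological_field_def)
  \<comment> \<open>A presentation exists, so the universally quantified condition is not vacuous
    and does force the class to vanish.\<close>
  have "(char_class H G act \<alpha> = H3_class H G act \<alpha> (\<lambda>_. 0)) \<longleftrightarrow>
      (\<forall>f \<theta> \<Phi>. presentation H G act \<alpha> f \<theta> \<Phi> \<longrightarrow>
        (\<exists>F\<in>cocycles G (ker_mod H \<alpha>) act 2. extends_theta H G \<alpha> \<theta> F))"
    using char_class_zeroI char_class_zeroD presentation_exists by meson
  moreover have "(char_class H G act \<alpha> = H3_class H G act \<alpha> (\<lambda>_. 0)) \<longleftrightarrow>
      (\<exists>(E :: ('k, 'h \<times> 'g) tla) \<iota> q \<phi>.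
        split_abelian_extension K (ker_mod H \<alpha>) act E G \<iota> q \<and>
        equivariant_equivalence H act \<alpha> E \<iota> q \<phi>)"
    using extension_of_char_class_zero char_class_zero_of_extension by blast
  \<comment> \<open>The remaining clause is the same implication for an extension carried by an
    arbitrary type.\<close>
  ultimately show ?thesis
    using char_class_zero_of_extension by blast
qed

end
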